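(* A matroid $M$ is an excluded series minor for the class of circuit-difference matroids if and only if either $M\cong U_{n,n+2}$ for some $n\ge 2$, or $M^*$ can be obtained (up to isomorphism) from $AG(r-1,2)+e$, for some $r\ge 3$, by deleting some set $X$ such that $e\notin X$ and $AG(r-1,2)|X$ does not contain a copy of $AG(r-3,2)$.
   Context: All matroids are finite. A matroid $M$ is circuit-difference if the symmetric difference $C_1\triangle C_2$ is a circuit of $M$ whenever $C_1$ and $C_2$ are distinct circuits of $M$ with $C_1\cap C_2\neq\emptyset$. A series contraction of a matroid is the contraction of an element $e$ for which there is an element $f\neq e$ such that $\{e,f\}$ is a cocircuit. A series minor of $M$ is a matroid obtained from $M$ by a (possibly empty) sequence of single-element deletions and series contractions. An excluded series minor for a class of matroids is a matroid that is not in the class but all of whose proper series minors are in the class. $U_{r,n}$ is the uniform matroid of rank $r$ on $n$ elements. $AG(r-1,2)$ is the rank-$r$ binary affine geometry, obtained from the binary projective geometry $PG(r-1,2)$ by deleting all the elements of a hyperplane; $AG(0,2)$ is a single non-loop element. $AG(r-1,2)+e$ denotes the unique (up to isomorphism) simple binary rank-$r$ single-element extension of $AG(r-1,2)$, where $e$ is the added element; equivalently, it is obtained from $PG(r-1,2)$ by deleting all elements of a hyperplane except for one element $e$ of that hyperplane. "$AG(r-1,2)|X$ contains a copy of $AG(r-3,2)$" means that some restriction of $AG(r-1,2)|X$ is isomorphic to $AG(r-3,2)$. *)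

theory Defs
  imports Complex_Main "HOL-Library.Z2" "HOL-Library.Function_Algebras"
begin

section \<open>Finite matroids\<close>

datatype 'a matroid = Matroid (ground: "'a set") (indep_sets: "'a set set")

definition is_matroid :: "'a matroid \<Rightarrow> bool" where
  "is_matroid M \<longleftrightarrow>
     finite (ground M) \<and>
     (\<forall>I\<in>indep_sets M. I \<subseteq> ground M) \<and>
     {} \<in> indep_sets M \<and>
     (\<forall>I\<in>indep_sets M. \<forall>J\<subseteq>I. J \<in> indep_sets M) \<and>
     (\<forall>I\<in>indep_sets M. \<forall>J\<in>indep_sets M. card I < card J \<longrightarrow>
        (\<exists>x\<in>J - I. insert x I \<in> indep_sets M))"

definition circuit :: "'a matroid \<Rightarrow> 'a set \<Rightarrow> bool" where
  "circuit M C \<longleftrightarrow>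
     C \<subseteq> ground M \<and> C \<notin> indep_sets M \<and> (\<forall>D. D \<subset> C \<longrightarrow> D \<in> indep_sets M)"

definition basis :: "'a matroid \<Rightarrow> 'a set \<Rightarrow> bool" where
  "basis M B \<longleftrightarrow> B \<in> indep_sets M \<and> (\<forall>I\<in>indep_sets M. B \<subseteq> I \<longrightarrow> I = B)"

text \<open>The bases of the dual are the complements of the bases.\<close>

definition dual :: "'a matroid \<Rightarrow> 'a matroid" where
  "dual M = Matroid (ground M) {I. \<exists>B. basis M B \<and> I \<subseteq> ground M - B}"

definition cocircuit :: "'a matroid \<Rightarrow> 'a set \<Rightarrow> bool" where
  "cocircuit M C \<longleftrightarrow> circuit (dual M) C"

definition restrict :: "'a matroid \<Rightarrow> 'a set \<Rightarrow> 'a matroid" where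
  "restrict M X = Matroid (ground M \<inter> X) {I \<in> indep_sets M. I \<subseteq> X}"

definition delete :: "'a matroid \<Rightarrow> 'a set \<Rightarrow> 'a matroid" where
  "delete M X = restrict M (ground M - X)"

definition contract :: "'a matroid \<Rightarrow> 'a set \<Rightarrow> 'a matroid" where
  "contract M X = dual (delete (dual M) X)"

definition isomorphic :: "'a matroid \<Rightarrow> 'b matroid \<Rightarrow> bool" where
  "isomorphic M N \<longleftrightarrow>
     (\<exists>f. bij_betw f (ground M) (ground N) \<and>
          (\<forall>I\<subseteq>ground M. I \<in> indep_sets M \<longleftrightarrow> f ` I \<in> indep_sets N))"

definition circuit_difference :: "'a matroid \<Rightarrow> bool" where
  "circuit_difference M \<longleftrightarrow>
     (\<forall>C1 C2. circuit M C1 \<longrightarrow> circuit M C2 \<longrightarrow> C1 \<noteq> C2 \<longrightarrow> C1 \<inter> C2 \<noteq> {} \<longrightarrow>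
        circuit M (sym_diff C1 C2))"

section \<open>Series minors\<close>

inductive series_step :: "'a matroid \<Rightarrow> 'a matroid \<Rightarrow> bool" where
  deletion: "e \<in> ground M \<Longrightarrow> series_step M (delete M {e})"
| series_contraction: "e \<noteq> f \<Longrightarrow> cocircuit M {e, f} \<Longrightarrow> series_step M (contract M {e})"

definition series_minor :: "'a matroid \<Rightarrow> 'a matroid \<Rightarrow> bool" where
  "series_minor N M \<longleftrightarrow> series_step\<^sup>*\<^sup>* M N"

definition excluded_series_minor :: "('a matroid \<Rightarrow> bool) \<Rightarrow> 'a matroid \<Rightarrow> bool" where
  "excluded_series_minor P M \<longleftrightarrow>
     \<not> P M \<and> (\<forall>N. series_minor N M \<and> N \<noteq> M \<longrightarrow> P N)"

section \<open>Uniform matroids and binary geometries\<close>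

definition uniform :: "nat \<Rightarrow> nat \<Rightarrow> nat matroid" where
  "uniform r n = Matroid {..<n} {I. I \<subseteq> {..<n} \<and> card I \<le> r}"

text \<open>A vector over GF(2) is a sequence of bits; $GF(2)^{d+1}$ consists of the sequences
  that vanish beyond index \<open>d\<close>.\<close>

type_synonym bitvec = "nat \<Rightarrow> bit"

definition bitvec_scale :: "bit \<Rightarrow> bitvec \<Rightarrow> bitvec" where
  "bitvec_scale c v = (\<lambda>i. c * v i)"

global_interpretation bitvec: vector_space bitvec_scale
  by unfold_locales (auto simp: bitvec_scale_def fun_eq_iff algebra_simps)

text \<open>\<open>PG d\<close> and \<open>AG d\<close> are $PG(d,2)$ and $AG(d,2)$, of rank \<open>d + 1\<close>. Over GF(2) every point
  of the projective geometry has exactly one nonzero representative.\<close>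

definition PG :: "nat \<Rightarrow> bitvec matroid" where
  "PG d = (let P = {v. v \<noteq> 0 \<and> (\<forall>i>d. v i = 0)}
           in Matroid P {I. I \<subseteq> P \<and> bitvec.independent I})"

text \<open>The linear automorphisms of \<open>PG d\<close> act transitively on pairs consisting of a hyperplane
  and a point on it. So up to isomorphism neither the choice of the hyperplane below matters,
  nor that of the point \<open>e\<close> in \<open>AG_plus\<close>.\<close>

definition hyperplane_at_infinity :: "nat \<Rightarrow> bitvec set" where
  "hyperplane_at_infinity d = {v \<in> ground (PG d). v 0 = 0}"

definition AG :: "nat \<Rightarrow> bitvec matroid" where
  "AG d = delete (PG d) (hyperplane_at_infinity d)"

text \<open>$AG(d,2)+e$, for a point \<open>e\<close> of the hyperplane at infinity.\<close>

definition AG_plus :: "nat \<Rightarrow> bitvec \<Rightarrow> bitvec matroid" where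
  "AG_plus d e = delete (PG d) (hyperplane_at_infinity d - {e})"

definition contains_copy :: "'a matroid \<Rightarrow> 'b matroid \<Rightarrow> bool" where
  "contains_copy M N \<longleftrightarrow> (\<exists>Y\<subseteq>ground M. isomorphic (restrict M Y) N)"

end

theory Submission
  imports Defs
begin

text \<open>Closure of the class under series minors leaves two conditions on an excluded series minor:
  any two elements are separated by a circuit (there is no series pair), and every bad pair, two
  meeting circuits \<open>C1\<close>, \<open>C2\<close> whose symmetric difference \<open>D\<close> is not a circuit, covers the ground set.
  If every other circuit also covers the ground set together with \<open>C1\<close>, the circuits are the
  complements of single elements. Otherwise \<open>D\<close> splits into two circuits, every circuit that meets
  \<open>C1 \<inter> C2\<close> contains it, so \<open>C1 \<inter> C2\<close> is a single element \<open>e\<close>, and the circuits together with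
  \<open>{}\<close> and \<open>D\<close> form a vector space \<open>Z\<close> over GF(2). Coordinates on \<open>Z\<close> with \<open>D\<close> as the 0-th
  coordinate represent the dual in \<open>AG(r-1,2)+e\<close>. A copy of \<open>AG(r-3,2)\<close> outside the image of \<open>D\<close>
  is an affine subspace of codimension two, and such a subspace that avoids \<open>D\<close> corresponds to a
  proper containment between two members of \<open>Z\<close> other than \<open>{}\<close> and \<open>D\<close>.\<close>

section \<open>Circuits, duals and minors\<close>

text \<open>Contrapositively, covering says that two distinct circuits sharing some \<open>x\<close>
  and missing some \<open>y\<close> have a circuit as symmetric difference. Closure of
  \<open>Z\<close> comes from chains of such sums; the difficulty is to find the shared and the
  missed element each time. Disjoint pairs and covering pairs offer none directly, and for them
  \<open>D\<close> is first added to one of the two circuits.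

  The outcome is that \<open>M\<close> is binary with cycle space \<open>Z\<close>, where
  \<open>D\<close> fails to be a circuit only because it splits into two. The dual of a binary
  matroid is represented by the functionals \<open>z \<mapsto> (x \<in> z)\<close> on the cycle
  space; \<open>parity_indep\<close> expresses their independence without vectors. Since
  \<open>D\<close> contains every element but \<open>e\<close>, its coordinate is one off
  \<open>e\<close> and zero at \<open>e\<close>: this is what places \<open>e\<close> at infinity
  and all other elements in the affine part.

  An isomorphic copy of an affine geometry is not given as a subspace. It is one because dependent
  four-point sets are preserved, which forces closure under \<open>a + b + c\<close>; counting then
  yields two explicit linear equations.\<close>

lemma matroid_finite: "is_matroid M \<Longrightarrow> finite (ground M)"
  by (simp add: is_matroid_def)

lemma indep_ground: "is_matroid M \<Longrightarrow> I \<in> indep_sets M \<Longrightarrow> I \<subseteq> ground M"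
  by (simp add: is_matroid_def)

lemma indep_finite: "is_matroid M \<Longrightarrow> I \<in> indep_sets M \<Longrightarrow> finite I"
  by (meson indep_ground matroid_finite finite_subset)

lemma indep_empty: "is_matroid M \<Longrightarrow> {} \<in> indep_sets M"
  by (simp add: is_matroid_def)

lemma indep_mono: "is_matroid M \<Longrightarrow> I \<in> indep_sets M \<Longrightarrow> J \<subseteq> I \<Longrightarrow> J \<in> indep_sets M"
  unfolding is_matroid_def by blast

lemma indep_augment:
  "is_matroid M \<Longrightarrow> I \<in> indep_sets M \<Longrightarrow> J \<in> indep_sets M \<Longrightarrow> card I < card J
    \<Longrightarrow> \<exists>x\<in>J - I. insert x I \<in> indep_sets M"
  unfolding is_matroid_def by blast

lemma indep_extend_within:
  assumes M: "is_matroid M" and I: "I \<in> indep_sets M" "I \<subseteq> X" and X: "X \<subseteq> ground M"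
  obtains B where "I \<subseteq> B" "B \<subseteq> X" "B \<in> indep_sets M"
    "\<And>J. J \<in> indep_sets M \<Longrightarrow> J \<subseteq> X \<Longrightarrow> card J \<le> card B"
proof -
  let ?P = "\<lambda>B. I \<subseteq> B \<and> B \<subseteq> X \<and> B \<in> indep_sets M"
  have finX: "finite X" using X matroid_finite[OF M] finite_subset by blast
  have "?P I" using I by simp
  moreover have "\<forall>B. ?P B \<longrightarrow> card B < Suc (card X)"
    using card_mono[OF finX] by (auto simp: less_Suc_eq_le)
  ultimately obtain B where B: "?P B" "\<And>B'. ?P B' \<Longrightarrow> card B' \<le> card B"
    using ex_has_greatest_nat[of ?P I card "Suc (card X)"] by blast
  have "card J \<le> card B" if J: "J \<in> indep_sets M" "J \<subseteq> X" for J
  proof (rule ccontr)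
    assume "\<not> ?thesis"
    then obtain x where x: "x \<in> J - B" "insert x B \<in> indep_sets M"
      using indep_augment[OF M, of B J] B J by auto
    then have "?P (insert x B)" using B J by auto
    then have "card (insert x B) \<le> card B" using B(2) by blast
    moreover have "finite B" using B(1) finX finite_subset by blast
    ultimately show False using x by simp
  qed
  with B(1) that show ?thesis by blast
qed

lemma basis_indep: "basis M B \<Longrightarrow> B \<in> indep_sets M"
  by (simp add: basis_def)

lemma basis_maximal: "basis M B \<Longrightarrow> I \<in> indep_sets M \<Longrightarrow> B \<subseteq> I \<Longrightarrow> I = B"
  by (simp add: basis_def)

lemma basis_extends:
  assumes M: "is_matroid M" and I: "I \<in> indep_sets M"
  obtains B where "I \<subseteq> B" "basis M B"
proof -
  obtain B where B: "I \<subseteq> B" "B \<subseteq> ground M" "B \<in> indep_sets M"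
    "\<And>J. J \<in> indep_sets M \<Longrightarrow> J \<subseteq> ground M \<Longrightarrow> card J \<le> card B"
    using indep_extend_within[OF M I indep_ground[OF M I] order_refl] by metis
  have "I' = B" if "I' \<in> indep_sets M" "B \<subseteq> I'" for I'
    using card_seteq[of I' B] B(4)[OF that(1)] that indep_ground[OF M] indep_finite[OF M] by blast
  with B that show ?thesis unfolding basis_def by blast
qed

lemma card_indep_le_basis:
  assumes M: "is_matroid M" and B: "basis M B" and I: "I \<in> indep_sets M"
  shows "card I \<le> card B"
proof (rule ccontr)
  assume "\<not> ?thesis"
  then obtain x where "x \<in> I - B" "insert x B \<in> indep_sets M"
    using indep_augment[OF M _ I, of B] B unfolding basis_def by auto
  then show False using B unfolding basis_def by blast
qed

lemma card_basis:
  assumes "is_matroid M" "basis M B" "basis M B'"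
  shows "card B = card B'"
  using card_indep_le_basis[OF assms(1)] assms(2,3) unfolding basis_def by (meson le_antisym)

lemma basis_if_card:
  assumes M: "is_matroid M" and B: "basis M B" and I: "I \<in> indep_sets M" "card B \<le> card I"
  shows "basis M I"
  unfolding basis_def
proof (intro conjI ballI impI)
  fix J assume "J \<in> indep_sets M" "I \<subseteq> J"
  then show "J = I"
    using card_seteq[of J I] card_indep_le_basis[OF M B, of J] I(2) indep_finite[OF M] by fastforce
qed (rule I)

lemma basis_ground: "is_matroid M \<Longrightarrow> basis M B \<Longrightarrow> B \<subseteq> ground M"
  unfolding basis_def using indep_ground by blast

lemma circuit_ground: "circuit M C \<Longrightarrow> C \<subseteq> ground M"
  unfolding circuit_def by blast

lemma circuit_dependent: "circuit M C \<Longrightarrow> C \<notin> indep_sets M"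
  unfolding circuit_def by blast

lemma circuit_psubset_indep: "circuit M C \<Longrightarrow> D \<subset> C \<Longrightarrow> D \<in> indep_sets M"
  unfolding circuit_def by blast

lemma circuit_subset_eq: "circuit M C \<Longrightarrow> circuit M C' \<Longrightarrow> C \<subseteq> C' \<Longrightarrow> C = C'"
  unfolding circuit_def by blast

lemma circuit_nonempty: "is_matroid M \<Longrightarrow> circuit M C \<Longrightarrow> C \<noteq> {}"
  unfolding circuit_def using indep_empty by blast

lemma dependent_contains_circuit:
  assumes M: "is_matroid M" and D: "D \<subseteq> ground M" "D \<notin> indep_sets M"
  obtains C where "circuit M C" "C \<subseteq> D"
proof -
  have "finite D" using D matroid_finite[OF M] finite_subset by blast
  then have "D \<subseteq> ground M \<Longrightarrow> D \<notin> indep_sets M \<Longrightarrow> \<exists>C. circuit M C \<and> C \<subseteq> D"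
  proof (induction rule: finite_psubset_induct)
    case (psubset D)
    show ?case
    proof (cases "circuit M D")
      case False
      then obtain D' where "D' \<subset> D" "D' \<notin> indep_sets M"
        using psubset.prems unfolding circuit_def by blast
      with psubset show ?thesis by (meson order.trans psubset_imp_subset)
    qed blast
  qed
  with D that show ?thesis by blast
qed

lemma indep_iff_no_circuit:
  assumes M: "is_matroid M" and "I \<subseteq> ground M"
  shows "I \<in> indep_sets M \<longleftrightarrow> (\<forall>C. circuit M C \<longrightarrow> \<not> C \<subseteq> I)"
  using assms dependent_contains_circuit[OF assms] indep_mono[OF M] circuit_dependent by metis

lemma circuit_in_insert:
  assumes M: "is_matroid M" and I: "I \<in> indep_sets M" and "insert x I \<notin> indep_sets M" "x \<in> ground M"
  obtains C where "circuit M C" "x \<in> C" "C \<subseteq> insert x I"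
proof -
  obtain C where C: "circuit M C" "C \<subseteq> insert x I"
    using dependent_contains_circuit[OF M, of "insert x I"] assms indep_ground[OF M I] by blast
  then have "x \<in> C" using indep_mono[OF M I, of C] circuit_dependent by blast
  with C that show ?thesis by blast
qed

lemma circuit_elimination:
  assumes M: "is_matroid M" and C: "circuit M C1" "circuit M C2" "C1 \<noteq> C2" and x: "x \<in> C1 \<inter> C2"
  obtains C3 where "circuit M C3" "C3 \<subseteq> C1 \<union> C2 - {x}"
proof -
  have gr: "C1 \<union> C2 \<subseteq> ground M" using C circuit_ground by blast
  have fin: "finite (C1 \<union> C2)" using gr matroid_finite[OF M] finite_subset by blast
  have "C1 \<union> C2 - {x} \<notin> indep_sets M"
  proof
    assume ind: "C1 \<union> C2 - {x} \<in> indep_sets M"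
    \<comment> \<open>Extending \<open>C2 - {y}\<close> to a largest independent subset of the union
      leaves out \<open>y\<close> and also some \<open>z\<close> of the dependent set
      \<open>C1\<close>. So independent subsets have at most two elements fewer than the union,
      while \<open>C1 \<union> C2 - {x}\<close> has only one fewer.\<close>
    obtain y where y: "y \<in> C2" "y \<notin> C1" using C circuit_subset_eq by blast
    have "C2 - {y} \<in> indep_sets M" using C(2) y unfolding circuit_def by blast
    then obtain B where B: "C2 - {y} \<subseteq> B" "B \<subseteq> C1 \<union> C2" "B \<in> indep_sets M"
      "\<And>J. J \<in> indep_sets M \<Longrightarrow> J \<subseteq> C1 \<union> C2 \<Longrightarrow> card J \<le> card B"
      using indep_extend_within[OF M _ _ gr, of "C2 - {y}"] by (metis Diff_subset le_supI2)
    have "y \<notin> B" using B indep_mono[OF M B(3)] circuit_dependent[OF C(2)] y by blast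
    moreover obtain z where z: "z \<in> C1" "z \<notin> B" using indep_mono[OF M B(3)] circuit_dependent[OF C(1)] by blast
    ultimately have "B \<subseteq> C1 \<union> C2 - {y,z}" using B by blast
    then have "card B \<le> card (C1 \<union> C2 - {y,z})" using fin card_mono by (meson finite_Diff)
    also have "\<dots> = card (C1 \<union> C2) - 2" using y z fin by (subst card_Diff_subset) (auto simp: card_insert_if)
    finally have "card B \<le> card (C1 \<union> C2) - 2" .
    moreover have "card (C1 \<union> C2 - {x}) \<le> card B" using B(4)[OF ind] by blast
    moreover have "card (C1 \<union> C2 - {x}) = card (C1 \<union> C2) - 1" using x fin by simp
    moreover have "card (C1 \<union> C2) \<ge> card {y,z}" using y z fin by (intro card_mono) auto
    then have "card (C1 \<union> C2) \<ge> 2" using y z by (cases "y = z") auto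
    ultimately show False by linarith
  qed
  then show ?thesis using dependent_contains_circuit[OF M] gr that by blast
qed

section \<open>The dual matroid\<close>

lemma ground_dual [simp]: "ground (dual M) = ground M"
  by (simp add: dual_def)

lemma dual_indep_iff: "I \<in> indep_sets (dual M) \<longleftrightarrow> (\<exists>B. basis M B \<and> I \<subseteq> ground M - B)"
  by (simp add: dual_def)

lemma basis_dual_iff:
  assumes M: "is_matroid M"
  shows "basis (dual M) B \<longleftrightarrow> B \<subseteq> ground M \<and> basis M (ground M - B)"
proof
  assume B: "basis (dual M) B"
  then obtain B' where B': "basis M B'" "B \<subseteq> ground M - B'"
    unfolding basis_def dual_indep_iff by blast
  then have "ground M - B' = B" using basis_maximal[OF B] by (auto simp: dual_indep_iff)
  with B' show "B \<subseteq> ground M \<and> basis M (ground M - B)"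
    using basis_ground[OF M B'(1)] double_diff[of B' "ground M" "ground M"] by auto
next
  assume B: "B \<subseteq> ground M \<and> basis M (ground M - B)"
  have *: "I = B" if "basis M B'" "I \<subseteq> ground M - B'" "B \<subseteq> I" for I B'
  proof -
    have "B' \<subseteq> ground M - B" using that basis_ground[OF M] by blast
    then have "B' = ground M - B"
      using card_basis[OF M that(1)] B matroid_finite[OF M] by (metis card_subset_eq finite_Diff)
    then show ?thesis using that B by blast
  qed
  moreover have "B \<subseteq> ground M - (ground M - B)" using B by blast
  ultimately have "B \<in> indep_sets (dual M)" unfolding dual_indep_iff using B by blast
  moreover have "\<And>I. I \<in> indep_sets (dual M) \<Longrightarrow> B \<subseteq> I \<Longrightarrow> I = B"
    unfolding dual_indep_iff using * by blast
  ultimately show "basis (dual M) B" unfolding basis_def by simp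
qed

lemma matroid_dual:
  assumes M: "is_matroid M"
  shows "is_matroid (dual M)"
proof -
  let ?E = "ground M"
  have fin: "finite ?E" using matroid_finite[OF M] .
  have aug: "\<exists>x\<in>J - I. \<exists>B. basis M B \<and> insert x I \<subseteq> ?E - B"
    if I: "basis M BI" "I \<subseteq> ?E - BI" and J: "basis M BJ" "J \<subseteq> ?E - BJ" and less: "card I < card J" for I J BI BJ
  proof -
    \<comment> \<open>A basis that avoids \<open>I\<close> and contains as much of \<open>BJ - I\<close> as possible leaves out an element of \<open>J\<close>.\<close>
    have "BJ - I \<in> indep_sets M" using indep_mono[OF M basis_indep[OF J(1)]] by blast
    then obtain B where B: "BJ - I \<subseteq> B" "B \<subseteq> ?E - I" "B \<in> indep_sets M"
      "\<And>K. K \<in> indep_sets M \<Longrightarrow> K \<subseteq> ?E - I \<Longrightarrow> card K \<le> card B"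
      using indep_extend_within[OF M, of "BJ - I" "?E - I"] basis_ground[OF M J(1)] by blast
    have "card BI \<le> card B" using B(4)[of BI] I basis_ground[OF M I(1)] unfolding basis_def by blast
    then have basB: "basis M B" using basis_if_card[OF M I(1) B(3)] by blast
    have "\<exists>x\<in>J - I. x \<notin> B"
    proof (rule ccontr)
      \<comment> \<open>\<open>J\<close> avoids \<open>BJ\<close>, so \<open>J - I\<close> and
        \<open>BJ - I\<close> are disjoint. Together they have at least
        \<open>card J + card BJ - card I\<close>, hence more than \<open>card BJ\<close>, elements
        and do not fit into \<open>B\<close>.\<close>
      assume "\<not> ?thesis"
      then have "(J - I) \<union> (BJ - I) \<subseteq> B" using B by blast
      moreover have "finite B" using B fin finite_subset by blast
      ultimately have "card ((J - I) \<union> (BJ - I)) \<le> card B" using card_mono by blast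
      moreover have "card ((J - I) \<union> (BJ - I)) = card (J - I) + card (BJ - I)"
        using J fin basis_ground[OF M] finite_subset by (intro card_Un_disjoint) (auto intro: finite_subset)
      moreover have fI: "finite I" "finite J" "finite BJ"
        using I J basis_ground[OF M] fin by (meson Diff_subset finite_subset order.trans)+
      have "card (J - I) + card (J \<inter> I) = card J" "card (BJ - I) + card (BJ \<inter> I) = card BJ"
        using fI by (metis add.commute card_Diff_subset_Int card_mono finite_Int inf_le1 le_add_diff_inverse)+
      moreover have "card (J \<inter> I) + card (BJ \<inter> I) = card ((J \<inter> I) \<union> (BJ \<inter> I))"
        using fI J by (intro card_Un_disjoint[symmetric]) auto
      moreover have "card ((J \<inter> I) \<union> (BJ \<inter> I)) \<le> card I" using fI by (intro card_mono) auto
      moreover have "card B = card BJ" using card_basis[OF M basB J(1)] .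
      ultimately show False using less by linarith
    qed
    then obtain x where x: "x \<in> J - I" "x \<notin> B" by blast
    then have "insert x I \<subseteq> ?E - B" using B I J by blast
    with x basB show ?thesis by blast
  qed
  obtain B where "basis M B" using basis_extends[OF M indep_empty[OF M]] by blast
  then show ?thesis
    unfolding is_matroid_def ground_dual dual_indep_iff
    using fin aug by (intro conjI ballI impI allI) (simp_all add: dual_indep_iff, blast+)
qed

section \<open>Restriction, deletion and contraction\<close>

lemma ground_restrict [simp]: "ground (restrict M X) = ground M \<inter> X"
  by (simp add: restrict_def)

lemma indep_restrict_iff [simp]: "I \<in> indep_sets (restrict M X) \<longleftrightarrow> I \<in> indep_sets M \<and> I \<subseteq> X"
  by (simp add: restrict_def)

lemma ground_delete [simp]: "ground (delete M X) = ground M - X"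
  by (auto simp: delete_def)

lemma indep_delete_iff: "is_matroid M \<Longrightarrow> I \<in> indep_sets (delete M X) \<longleftrightarrow> I \<in> indep_sets M \<and> I \<inter> X = {}"
  using indep_ground by (auto simp: delete_def)

lemma matroid_restrict:
  assumes "is_matroid M"
  shows "is_matroid (restrict M X)"
  unfolding is_matroid_def
proof (intro conjI ballI allI impI)
  fix I J assume "I \<in> indep_sets (restrict M X)" "J \<in> indep_sets (restrict M X)" "card I < card J"
  then show "\<exists>x\<in>J - I. insert x I \<in> indep_sets (restrict M X)"
    using indep_augment[OF assms, of I J] by auto
qed (use assms matroid_finite indep_ground indep_empty indep_mono in \<open>auto, fastforce+\<close>)

lemma matroid_delete: "is_matroid M \<Longrightarrow> is_matroid (delete M X)"
  unfolding delete_def by (rule matroid_restrict)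

lemma circuit_delete_iff:
  "is_matroid M \<Longrightarrow> circuit (delete M X) C \<longleftrightarrow> circuit M C \<and> C \<inter> X = {}"
  unfolding circuit_def by (auto simp: indep_delete_iff)

lemma ground_contract [simp]: "ground (contract M X) = ground M - X"
  by (simp add: contract_def)

lemma matroid_contract: "is_matroid M \<Longrightarrow> is_matroid (contract M X)"
  unfolding contract_def by (intro matroid_dual matroid_delete)

text \<open>Contraction is defined through the dual. As \<open>e\<close> is not a loop, some basis
  of the dual avoids it, so deleting \<open>e\<close> from the dual keeps the rank and the remaining
  bases are the bases of the dual that avoid \<open>e\<close>.\<close>

lemma indep_contract_iff:
  assumes M: "is_matroid M" and e: "{e} \<in> indep_sets M"
  shows "I \<in> indep_sets (contract M {e}) \<longleftrightarrow> e \<notin> I \<and> insert e I \<in> indep_sets M"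
proof -
  let ?E = "ground M"
  have Md: "is_matroid (dual M)" using matroid_dual[OF M] .
  have eE: "e \<in> ?E" using indep_ground[OF M e] by blast
  obtain B0 where B0: "e \<in> B0" "basis M B0" using basis_extends[OF M e] by blast
  then have B0d: "basis (dual M) (?E - B0)"
    using basis_dual_iff[OF M] basis_ground[OF M] by (simp add: double_diff)
  have bas: "basis (delete (dual M) {e}) B \<longleftrightarrow> basis (dual M) B \<and> e \<notin> B" for B
  proof
    assume B: "basis (delete (dual M) {e}) B"
    then have ind: "B \<in> indep_sets (dual M)" "e \<notin> B"
      unfolding basis_def indep_delete_iff[OF Md] by auto
    have "?E - B0 \<in> indep_sets (delete (dual M) {e})"
      using basis_indep[OF B0d] B0(1) unfolding indep_delete_iff[OF Md] by blast
    then have "card (?E - B0) \<le> card B" using card_indep_le_basis[OF matroid_delete[OF Md] B] by blast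
    then show "basis (dual M) B \<and> e \<notin> B" using basis_if_card[OF Md B0d] ind by blast
  next
    assume "basis (dual M) B \<and> e \<notin> B"
    then have "B \<in> indep_sets (dual M)" "e \<notin> B"
      "\<And>I. I \<in> indep_sets (dual M) \<Longrightarrow> B \<subseteq> I \<Longrightarrow> I = B"
      using basis_indep basis_maximal by metis+
    then show "basis (delete (dual M) {e}) B"
      unfolding basis_def by (simp add: Ball_def indep_delete_iff[OF Md])
  qed
  show ?thesis
  proof
    assume "I \<in> indep_sets (contract M {e})"
    then obtain B where B: "basis (dual M) B" "e \<notin> B" "I \<subseteq> ?E - {e} - B"
      unfolding contract_def dual_indep_iff bas by auto
    then have "insert e I \<subseteq> ?E - B" "?E - B \<in> indep_sets M"
      using eE basis_dual_iff[OF M] unfolding basis_def by auto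
    then show "e \<notin> I \<and> insert e I \<in> indep_sets M" using indep_mono[OF M] B by blast
  next
    assume I: "e \<notin> I \<and> insert e I \<in> indep_sets M"
    then obtain B where B: "insert e I \<subseteq> B" "basis M B" using basis_extends[OF M] by blast
    then have "basis (dual M) (?E - B)"
      using basis_dual_iff[OF M] basis_ground[OF M] by (simp add: double_diff)
    moreover have "I \<subseteq> ?E - {e} - (?E - B)" using B I basis_ground[OF M B(2)] by blast
    ultimately show "I \<in> indep_sets (contract M {e})"
      unfolding contract_def dual_indep_iff bas using B by auto
  qed
qed

section \<open>Bad pairs\<close>

definition bad_pair :: "'a matroid \<Rightarrow> 'a set \<Rightarrow> 'a set \<Rightarrow> bool" where
  "bad_pair M C1 C2 \<longleftrightarrow> circuit M C1 \<and> circuit M C2 \<and> C1 \<noteq> C2 \<and> C1 \<inter> C2 \<noteq> {} \<and>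
     \<not> circuit M (sym_diff C1 C2)"

lemma bad_pair_circuits: "bad_pair M C1 C2 \<Longrightarrow> circuit M C1" "bad_pair M C1 C2 \<Longrightarrow> circuit M C2"
  by (simp_all add: bad_pair_def)

lemma circuit_difference_iff_no_bad_pair: "circuit_difference M \<longleftrightarrow> (\<nexists>C1 C2. bad_pair M C1 C2)"
  unfolding circuit_difference_def bad_pair_def by blast

section \<open>Series pairs and minimal obstructions\<close>

definition circuits_separate :: "'a matroid \<Rightarrow> bool" where
  "circuits_separate M \<longleftrightarrow>
     (\<forall>x\<in>ground M. \<forall>y\<in>ground M. x \<noteq> y \<longrightarrow> (\<exists>C. circuit M C \<and> (x \<in> C) \<noteq> (y \<in> C)))"

text \<open>The pair meets every basis, while each of its elements is missed by some basis. If a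
  circuit \<open>C\<close> contained \<open>x\<close> but not \<open>y\<close>, then
  \<open>C - {x}\<close> would extend to a basis avoiding \<open>y\<close>; this basis would have to
  contain \<open>x\<close>, and with it all of \<open>C\<close>.\<close>

lemma series_pair_not_separated:
  assumes M: "is_matroid M" and ef: "e \<noteq> f" "cocircuit M {e, f}"
  shows "{e} \<in> indep_sets M" "\<And>C. circuit M C \<Longrightarrow> e \<in> C \<longleftrightarrow> f \<in> C"
proof -
  have gr: "e \<in> ground M" "f \<in> ground M" and
    dep: "{e,f} \<notin> indep_sets (dual M)" and ind: "{e} \<in> indep_sets (dual M)" "{f} \<in> indep_sets (dual M)"
    using ef unfolding cocircuit_def circuit_def by auto
  have meet: "e \<in> B \<or> f \<in> B" if "basis M B" for B
    using dep gr that unfolding dual_indep_iff by blast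
  obtain Be where Be: "basis M Be" "e \<notin> Be" using ind(1) unfolding dual_indep_iff by blast
  obtain Bf where Bf: "basis M Bf" "f \<notin> Bf" using ind(2) unfolding dual_indep_iff by blast
  show "{e} \<in> indep_sets M"
    using indep_mono[OF M basis_indep[OF Bf(1)]] meet[OF Bf(1)] Bf(2) by blast
  have half: "y \<in> C" if C: "circuit M C" "x \<in> C" and B0: "basis M B0" "y \<notin> B0"
    and xy: "{x,y} = {e,f}" for C x y B0
  proof (rule ccontr)
    assume y: "y \<notin> C"
    have "C - {x} \<in> indep_sets M" "C - {x} \<subseteq> ground M - {y}"
      using C y circuit_ground[OF C(1)] unfolding circuit_def by auto
    then obtain B where B: "C - {x} \<subseteq> B" "B \<subseteq> ground M - {y}" "B \<in> indep_sets M"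
      "\<And>J. J \<in> indep_sets M \<Longrightarrow> J \<subseteq> ground M - {y} \<Longrightarrow> card J \<le> card B"
      using indep_extend_within[OF M] by (metis Diff_subset)
    have "card B0 \<le> card B" using B(4)[OF basis_indep[OF B0(1)]] B0 basis_ground[OF M B0(1)] by blast
    then have "basis M B" using basis_if_card[OF M B0(1) B(3)] by blast
    then have "x \<in> B" using meet[of B] xy B(2) by (metis Diff_iff doubleton_eq_iff insert_iff subsetD)
    then have "C \<subseteq> B" using B by blast
    then show False using indep_mono[OF M B(3)] circuit_dependent[OF C(1)] by blast
  qed
  show "e \<in> C \<longleftrightarrow> f \<in> C" if "circuit M C" for C
    using half[OF that _ Bf] half[OF that _ Be, of f] by blast
qed

text \<open>In general only the minimal nonempty sets \<open>C - {e}\<close> are circuits of the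
  contraction. For a series pair all of them are: if \<open>e \<notin> C\<close>, a circuit through
  \<open>e\<close> inside \<open>insert e C\<close> would also contain \<open>f\<close>, so
  \<open>f \<in> C\<close> and therefore \<open>e \<in> C\<close>.\<close>

lemma circuit_contract_series_iff:
  assumes M: "is_matroid M" and ef: "e \<noteq> f" "cocircuit M {e, f}"
  shows "circuit (contract M {e}) C' \<longleftrightarrow> (\<exists>C. circuit M C \<and> C' = C - {e})"
proof -
  note e = series_pair_not_separated(1)[OF M ef]
  note iff = series_pair_not_separated(2)[OF M ef]
  note ind = indep_contract_iff[OF M e]
  have *: "circuit (contract M {e}) (C - {e})" if C: "circuit M C" for C
  proof (cases "e \<in> C")
    case True
    have "insert e D \<in> indep_sets M \<and> e \<notin> D" if "D \<subset> C - {e}" for D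
      using that True circuit_psubset_indep[OF C, of "insert e D"] by blast
    with True C circuit_ground[OF C] circuit_dependent[OF C] show ?thesis
      unfolding circuit_def[of "contract M {e}"] ind by (auto simp: insert_absorb)
  next
    case False
    have "insert e D \<in> indep_sets M" if D: "D \<subset> C" for D
    proof (rule ccontr)
      assume dep: "insert e D \<notin> indep_sets M"
      have "D \<in> indep_sets M" using C D unfolding circuit_def by blast
      then obtain C' where "circuit M C'" "e \<in> C'" "C' \<subseteq> insert e D"
        using circuit_in_insert[OF M _ dep] indep_ground[OF M e] by blast
      then have "f \<in> C" using iff ef D by blast
      then show False using iff[OF C] False by blast
    qed
    moreover have "insert e C \<notin> indep_sets M"
      using circuit_dependent[OF C] indep_mono[OF M, of "insert e C" C] by blast
    ultimately show ?thesis using circuit_ground[OF C] False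
      unfolding circuit_def[of "contract M {e}"] ind by auto
  qed
  show ?thesis
  proof
    assume C': "circuit (contract M {e}) C'"
    then have "e \<notin> C'" "insert e C' \<subseteq> ground M"
      using circuit_ground[OF C'] indep_ground[OF M e] by auto
    moreover have "insert e C' \<notin> indep_sets M" using circuit_dependent[OF C'] ind \<open>e \<notin> C'\<close> by blast
    ultimately obtain C where C: "circuit M C" "C \<subseteq> insert e C'"
      using dependent_contains_circuit[OF M] by metis
    then have "C - {e} = C'" using circuit_subset_eq[OF *[OF C(1)] C'] by blast
    with C show "\<exists>C. circuit M C \<and> C' = C - {e}" by blast
  qed (use * in blast)
qed

text \<open>A circuit contains \<open>f\<close> exactly when it contains \<open>e\<close>, so no
  information is lost with \<open>e\<close>: equality, disjointness and symmetric differences of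
  circuits can be read off the remaining elements.\<close>

lemma bad_pair_contract_series_iff:
  assumes M: "is_matroid M" and ef: "e \<noteq> f" "cocircuit M {e, f}"
    and C: "circuit M C1" "circuit M C2"
  shows "bad_pair (contract M {e}) (C1 - {e}) (C2 - {e}) \<longleftrightarrow> bad_pair M C1 C2"
proof -
  note iff = series_pair_not_separated(2)[OF M ef]
  note cc = circuit_contract_series_iff[OF M ef]
  have e1: "e \<in> C1 \<longleftrightarrow> f \<in> C1" and e2: "e \<in> C2 \<longleftrightarrow> f \<in> C2" using iff C by auto
  have "C1 - {e} = C2 - {e} \<longleftrightarrow> C1 = C2" using e1 e2 ef(1) by blast
  moreover have "(C1 - {e}) \<inter> (C2 - {e}) = {} \<longleftrightarrow> C1 \<inter> C2 = {}" using e1 e2 ef(1) by blast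
  moreover have "circuit (contract M {e}) (sym_diff (C1 - {e}) (C2 - {e})) \<longleftrightarrow> circuit M (sym_diff C1 C2)"
  proof
    assume "circuit M (sym_diff C1 C2)"
    moreover have "sym_diff (C1 - {e}) (C2 - {e}) = sym_diff C1 C2 - {e}" by blast
    ultimately show "circuit (contract M {e}) (sym_diff (C1 - {e}) (C2 - {e}))" unfolding cc by blast
  next
    assume "circuit (contract M {e}) (sym_diff (C1 - {e}) (C2 - {e}))"
    then obtain C3 where C3: "circuit M C3" "sym_diff (C1 - {e}) (C2 - {e}) = C3 - {e}" unfolding cc by blast
    have "C3 = sym_diff C1 C2" using C3(2) e1 e2 iff[OF C3(1)] ef(1) by blast
    with C3 show "circuit M (sym_diff C1 C2)" by simp
  qed
  ultimately show ?thesis using C cc unfolding bad_pair_def by blast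
qed

lemma series_step_matroid: "series_step M N \<Longrightarrow> is_matroid M \<Longrightarrow> is_matroid N"
  by (cases rule: series_step.cases) (auto simp: matroid_delete matroid_contract)

lemma bad_pair_delete_iff:
  "is_matroid M \<Longrightarrow> bad_pair (delete M X) C1 C2 \<longleftrightarrow> bad_pair M C1 C2 \<and> (C1 \<union> C2) \<inter> X = {}"
  unfolding bad_pair_def by (simp add: circuit_delete_iff) blast

lemma circuit_difference_series_step:
  assumes M: "is_matroid M" and cd: "circuit_difference M" and step: "series_step M N"
  shows "circuit_difference N"
  using step
proof cases
  case (deletion e)
  with cd show ?thesis by (simp add: circuit_difference_iff_no_bad_pair bad_pair_delete_iff[OF M])
next
  case (series_contraction e f)
  show ?thesis
    unfolding circuit_difference_iff_no_bad_pair
  proof clarify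
    fix C1 C2 assume bad: "bad_pair N C1 C2"
    then obtain C1' C2' where "circuit M C1'" "C1 = C1' - {e}" "circuit M C2'" "C2 = C2' - {e}"
      using circuit_contract_series_iff[OF M series_contraction(2,3)] series_contraction(1)
        bad_pair_circuits[OF bad] by metis
    then show False
      using bad cd bad_pair_contract_series_iff[OF M series_contraction(2,3)] series_contraction(1)
      unfolding circuit_difference_iff_no_bad_pair by blast
  qed
qed

text \<open>Converse of \<open>series_pair_not_separated\<close>. A basis \<open>B\<close> missing
  both elements would give a circuit in \<open>insert x B\<close> that contains \<open>x\<close> and
  not \<open>y\<close>. The circuit \<open>C\<close> excludes coloops: \<open>C - {x}\<close> and
  \<open>C - {y}\<close> extend to bases missing \<open>x\<close> and \<open>y\<close>
  respectively.\<close>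

lemma cocircuit_if_not_separated:
  assumes M: "is_matroid M" and C: "circuit M C" "x \<in> C" and xy: "x \<noteq> y"
    and nsep: "\<And>C. circuit M C \<Longrightarrow> x \<in> C \<longleftrightarrow> y \<in> C"
  shows "cocircuit M {x, y}"
proof -
  have y: "y \<in> C" using nsep C by blast
  have gr: "x \<in> ground M" "y \<in> ground M" using circuit_ground[OF C(1)] C(2) y by auto
  have "{x,y} \<notin> indep_sets (dual M)"
  proof
    assume "{x,y} \<in> indep_sets (dual M)"
    then obtain B where B: "basis M B" "x \<notin> B" "y \<notin> B" unfolding dual_indep_iff by blast
    then have "insert x B \<notin> indep_sets M" using basis_maximal by blast
    then obtain C' where "circuit M C'" "x \<in> C'" "C' \<subseteq> insert x B"
      using circuit_in_insert[OF M basis_indep[OF B(1)]] gr by blast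
    then show False using nsep B xy by blast
  qed
  moreover have sing: "D \<in> indep_sets (dual M)" if z: "z \<in> C" and D: "D \<subseteq> {z}" for z D
  proof -
    have "C - {z} \<in> indep_sets M" using C z unfolding circuit_def by blast
    then obtain B where B: "C - {z} \<subseteq> B" "basis M B" using basis_extends[OF M] by blast
    then have "z \<notin> B"
      using indep_mono[OF M basis_indep[OF B(2)], of C] circuit_dependent[OF C(1)] by blast
    then show ?thesis using D B circuit_ground[OF C(1)] z unfolding dual_indep_iff by blast
  qed
  have "D \<in> indep_sets (dual M)" if "D \<subset> {x,y}" for D
  proof -
    have "D \<subseteq> {x} \<or> D \<subseteq> {y}" using that by blast
    then show ?thesis using sing C(2) y by blast
  qed
  ultimately show ?thesis unfolding cocircuit_def circuit_def using gr by simp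
qed

text \<open>A bad pair survives the deletion of an element outside it and every series contraction,
  so minimality rules both out. Conversely, a covering bad pair is destroyed by any deletion,
  separation leaves no series pair to contract, and after the first step the class is never left
  again.\<close>

lemma excluded_series_minor_iff:
  assumes M: "is_matroid M"
  shows "excluded_series_minor circuit_difference M \<longleftrightarrow>
    (\<exists>C1 C2. bad_pair M C1 C2) \<and> (\<forall>C1 C2. bad_pair M C1 C2 \<longrightarrow> C1 \<union> C2 = ground M) \<and>
    circuits_separate M"
    (is "?L \<longleftrightarrow> ?R")
proof
  assume ex: ?L
  then obtain C1 C2 where bad: "bad_pair M C1 C2"
    unfolding excluded_series_minor_def circuit_difference_iff_no_bad_pair by blast
  have step_cd: "circuit_difference N" if "series_step M N" "ground N \<noteq> ground M" for N
  proof -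
    have "series_minor N M" unfolding series_minor_def using that by blast
    then show ?thesis using ex that unfolding excluded_series_minor_def by blast
  qed
  have cover: "C1 \<union> C2 = ground M" if bad: "bad_pair M C1 C2" for C1 C2
  proof (rule ccontr)
    assume "C1 \<union> C2 \<noteq> ground M"
    then obtain x where x: "x \<in> ground M" "x \<notin> C1 \<union> C2"
      using bad circuit_ground unfolding bad_pair_def by blast
    then have "circuit_difference (delete M {x})"
      by (intro step_cd series_step.deletion) auto
    then show False
      using bad x unfolding circuit_difference_iff_no_bad_pair bad_pair_delete_iff[OF M] by blast
  qed
  have "circuits_separate M"
    unfolding circuits_separate_def
  proof (intro ballI impI, rule ccontr)
    fix x y assume xy: "x \<in> ground M" "y \<in> ground M" "x \<noteq> y"
      and nsep: "\<nexists>C. circuit M C \<and> (x \<in> C) \<noteq> (y \<in> C)"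
    \<comment> \<open>Two coloops are not separated either, without forming a cocircuit; the
      covering bad pair excludes them by putting \<open>x\<close> on a circuit.\<close>
    obtain C where "circuit M C" "x \<in> C" using cover[OF bad] bad xy unfolding bad_pair_def by blast
    then have coc: "cocircuit M {x,y}" using cocircuit_if_not_separated[OF M _ _ xy(3)] nsep by blast
    then have "circuit_difference (contract M {x})"
      using xy by (intro step_cd series_step.series_contraction[of x y]) auto
    moreover have "bad_pair (contract M {x}) (C1 - {x}) (C2 - {x})"
      using bad_pair_contract_series_iff[OF M xy(3) coc bad_pair_circuits[OF bad]] bad by blast
    ultimately show False unfolding circuit_difference_iff_no_bad_pair by blast
  qed
  with bad cover show ?R by blast
next
  assume R: ?R
  have first: "circuit_difference N" if "series_step M N" for N
    using that
  proof cases
    case (deletion e)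
    then show ?thesis using R
      unfolding circuit_difference_iff_no_bad_pair by (auto simp: bad_pair_delete_iff[OF M])
  next
    case (series_contraction e f)
    have "e \<in> ground M" "f \<in> ground M"
      using series_contraction(3) unfolding cocircuit_def circuit_def by auto
    then obtain C where "circuit M C" "(e \<in> C) \<noteq> (f \<in> C)"
      using R series_contraction(2) unfolding circuits_separate_def by blast
    then show ?thesis using series_pair_not_separated(2)[OF M series_contraction(2,3)] by blast
  qed
  have later: "is_matroid N \<and> circuit_difference N" if "series_step\<^sup>*\<^sup>* N1 N" "series_step M N1" for N N1
    using that
    by (induction rule: rtranclp_induct)
       (auto simp: first series_step_matroid M circuit_difference_series_step)
  show ?L
    unfolding excluded_series_minor_def
  proof (intro conjI allI impI)
    show "\<not> circuit_difference M" using R unfolding circuit_difference_iff_no_bad_pair by blast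
    fix N assume N: "series_minor N M \<and> N \<noteq> M"
    then obtain N1 where "series_step M N1" "series_step\<^sup>*\<^sup>* N1 N"
      unfolding series_minor_def by (metis converse_rtranclpE)
    then show "circuit_difference N" using later by blast
  qed
qed

text \<open>The circuits are the nonempty members of a binary vector space, except for the
  complement of one element.\<close>

definition almost_cycle_space :: "'a matroid \<Rightarrow> 'a \<Rightarrow> 'a set set \<Rightarrow> bool" where
  "almost_cycle_space M e Z \<longleftrightarrow>
     e \<in> ground M \<and> {} \<in> Z \<and> ground M - {e} \<in> Z \<and> (\<forall>z\<in>Z. \<forall>w\<in>Z. sym_diff z w \<in> Z) \<and>
     (\<forall>C. circuit M C \<longleftrightarrow> C \<in> Z \<and> C \<noteq> {} \<and> C \<noteq> ground M - {e}) \<and>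
     (\<exists>z\<in>Z. e \<in> z) \<and> (\<exists>z\<in>Z. z \<noteq> {} \<and> z \<subset> ground M - {e}) \<and>
     (\<forall>x\<in>ground M. \<forall>y\<in>ground M. x \<noteq> y \<longrightarrow> (\<exists>z\<in>Z. (x \<in> z) \<noteq> (y \<in> z)))"

section \<open>Circuits when every bad pair covers the ground set\<close>

locale covering_bad_pair =
  fixes M :: "'a matroid" and C1 C2
  assumes M: "is_matroid M" and bad: "bad_pair M C1 C2"
    and bad_covers: "\<And>C C'. bad_pair M C C' \<Longrightarrow> C \<union> C' = ground M"
    and separate: "circuits_separate M"
begin

definition "D = sym_diff C1 C2"

lemma C12: "circuit M C1" "circuit M C2" "C1 \<noteq> C2" "C1 \<inter> C2 \<noteq> {}" "C1 \<union> C2 = ground M"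
  using bad bad_covers[OF bad] unfolding bad_pair_def by simp_all

lemma not_circuit_D: "\<not> circuit M D"
  using bad unfolding bad_pair_def D_def by auto

text \<open>The main source of new circuits: \<open>x\<close> shows that the two circuits meet and
  \<open>y\<close> that they do not cover, so they cannot be a bad pair.\<close>

lemma circuit_sym_diff:
  assumes "circuit M C" "circuit M C'" "C \<noteq> C'" "x \<in> C" "x \<in> C'" "y \<in> ground M" "y \<notin> C" "y \<notin> C'"
  shows "circuit M (sym_diff C C')"
  using bad_covers[of C C'] assms unfolding bad_pair_def by blast

text \<open>If \<open>D\<close> contained no circuit, it would become one itself: pass from
  \<open>A\<close> to \<open>A \<triangle> C2\<close> (both summands miss \<open>m\<close>), then to
  \<open>A \<triangle> C2 \<triangle> C1\<close> (both miss \<open>p\<close>), and add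
  \<open>A\<close> again. For the last sum, \<open>A\<close> and \<open>C1 \<triangle> A\<close> are
  not inside \<open>D\<close>, so they have elements \<open>q\<close> and \<open>s\<close> in
  \<open>C1 \<inter> C2\<close>; \<open>q\<close> is shared and \<open>s\<close> is missed.\<close>

lemma circuit_in_D_aux:
  assumes A: "circuit M A" "circuit M (sym_diff C1 A)"
    and y: "y \<in> ground M" "y \<notin> C1" "y \<notin> A" and m: "m \<in> ground M" "m \<notin> A" "m \<notin> C2"
  shows "\<exists>D1. circuit M D1 \<and> D1 \<subseteq> D"
proof (rule ccontr)
  assume no: "\<nexists>D1. circuit M D1 \<and> D1 \<subseteq> D"
  have "A \<noteq> C1" using circuit_nonempty[OF M A(2)] by blast
  then obtain p where p: "p \<in> A" "p \<notin> C1" using circuit_subset_eq[OF A(1) C12(1)] by blast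
  have p2: "p \<in> C2" "p \<in> ground M" using p circuit_ground[OF A(1)] C12(5) by auto
  have y2: "y \<in> C2" using y C12(5) by blast
  have c5: "circuit M (sym_diff A C2)"
    using circuit_sym_diff[OF A(1) C12(2) _ p(1) p2(1) m] y2 y by blast
  have "\<not> sym_diff A C2 \<subseteq> C2" using circuit_subset_eq[OF c5 C12(2)] p p2 by blast
  then obtain u where u: "u \<in> sym_diff A C2" "u \<in> C1"
    using circuit_ground[OF c5] C12(5) by blast
  have c6: "circuit M (sym_diff (sym_diff A C2) C1)"
    using circuit_sym_diff[OF c5 C12(1) _ u p2(2)] y y2 p p2 by blast
  obtain q where q: "q \<in> A" "q \<in> C1" "q \<in> C2"
    using no A(1) circuit_ground[OF A(1)] C12(5) unfolding D_def by blast
  obtain s where s: "s \<notin> A" "s \<in> C1" "s \<in> C2"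
    using no A(2) circuit_ground[OF A(2)] C12(5) unfolding D_def by blast
  obtain d where "d \<in> D" using C12(3) unfolding D_def by blast
  then have "A \<noteq> sym_diff (sym_diff A C2) C1" unfolding D_def by blast
  then have "circuit M (sym_diff A (sym_diff (sym_diff A C2) C1))"
    using q s C12(5) by (intro circuit_sym_diff[OF A(1) c6, of q s]) auto
  moreover have "sym_diff A (sym_diff (sym_diff A C2) C1) = D" unfolding D_def by blast
  ultimately show False using not_circuit_D by simp
qed

lemma circuit_in_D:
  assumes C3: "circuit M C3" "C3 \<noteq> C1" "C3 \<union> C1 \<noteq> ground M"
  shows "\<exists>D1. circuit M D1 \<and> D1 \<subseteq> D"
proof -
  obtain y where y: "y \<in> ground M" "y \<notin> C1" "y \<notin> C3"
    using C3 circuit_ground[OF C3(1)] circuit_ground[OF C12(1)] by blast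
  have "\<not> C3 \<subseteq> C2" using circuit_subset_eq[OF C3(1) C12(2)] y C12(5) by blast
  then obtain x where x: "x \<in> C3" "x \<in> C1" using circuit_ground[OF C3(1)] C12(5) by blast
  have C4: "circuit M (sym_diff C1 C3)"
    using circuit_sym_diff[OF C12(1) C3(1) _ x(2,1) y] C3 by blast
  obtain w where w: "w \<in> C1" "w \<notin> C2" using circuit_subset_eq[OF C12(1,2)] C12(3) by blast
  have wE: "w \<in> ground M" using w C12(5) by blast
  \<comment> \<open>The element \<open>w\<close> of \<open>C1 - C2\<close> lies in exactly one of
    \<open>C3\<close> and \<open>C1 \<triangle> C3\<close>. The other one takes the role of
    \<open>A\<close>, with \<open>m = w\<close>.\<close>
  show ?thesis
  proof (cases "w \<in> C3")
    case False
    show ?thesis by (rule circuit_in_D_aux[OF C3(1) C4 y wE False w(2)])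
  next
    case True
    have "sym_diff C1 (sym_diff C1 C3) = C3" by blast
    then have "circuit M (sym_diff C1 (sym_diff C1 C3))" using C3(1) by simp
    then show ?thesis using True y w wE by (intro circuit_in_D_aux[OF C4, of y w]) auto
  qed
qed

end

section \<open>The case of a circuit inside \<open>D\<close>\<close>

locale bad_pair_with_circuit = covering_bad_pair +
  fixes D1
  assumes D1: "circuit M D1" "D1 \<subseteq> D"
begin

lemma D_meets:
  assumes "circuit M X" "X \<subseteq> D"
  obtains p q where "p \<in> X" "p \<in> C1" "p \<notin> C2" "q \<in> X" "q \<in> C2" "q \<notin> C1"
proof -
  have "\<not> X \<subseteq> C2" "\<not> X \<subseteq> C1"
    using circuit_subset_eq[OF assms(1) C12(2)] circuit_subset_eq[OF assms(1) C12(1)] assms C12(4)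
    unfolding D_def by blast+
  then show ?thesis using assms that unfolding D_def by blast
qed

text \<open>\<open>D - X\<close> equals \<open>C1 \<triangle> X \<triangle> C2\<close>. An element
  \<open>y\<close> of \<open>D - X\<close> decides the order of summation: \<open>X\<close> is added
  first to the one of \<open>C1\<close>, \<open>C2\<close> that misses \<open>y\<close>. The second
  sum shares an element \<open>k\<close> of \<open>C1 \<inter> C2\<close>.\<close>

lemma circuit_D_Diff:
  assumes X: "circuit M X" "X \<subseteq> D"
  shows "circuit M (D - X)"
proof -
  obtain p q where p: "p \<in> X" "p \<in> C1" "p \<notin> C2" and q: "q \<in> X" "q \<in> C2" "q \<notin> C1"
    using D_meets[OF X] by blast
  obtain k where k: "k \<in> C1" "k \<in> C2" using C12(4) by blast
  have kX: "k \<notin> X" using X k unfolding D_def by blast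
  have "X \<noteq> D" using not_circuit_D X(1) by auto
  then obtain y where y: "y \<in> D" "y \<notin> X" using X(2) by blast
  have E: "p \<in> ground M" "q \<in> ground M" "y \<in> ground M" using p q y C12(5) unfolding D_def by auto
  consider "y \<notin> C1" | "y \<notin> C2" using y unfolding D_def by blast
  then show ?thesis
  proof cases
    case 1
    have c3: "circuit M (sym_diff C1 X)"
      using circuit_sym_diff[OF C12(1) X(1) _ p(2,1) E(3) 1 y(2)] k kX by blast
    have "sym_diff C1 X \<noteq> C2" using y 1 unfolding D_def by blast
    then have "circuit M (sym_diff (sym_diff C1 X) C2)"
      using k kX p E by (intro circuit_sym_diff[OF c3 C12(2), of k p]) auto
    moreover have "sym_diff (sym_diff C1 X) C2 = D - X" using X unfolding D_def by blast
    ultimately show ?thesis by simp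
  next
    case 2
    have c3: "circuit M (sym_diff C2 X)"
      using circuit_sym_diff[OF C12(2) X(1) _ q(2,1) E(3) 2 y(2)] k kX by blast
    have "sym_diff C2 X \<noteq> C1" using y 2 unfolding D_def by blast
    then have "circuit M (sym_diff (sym_diff C2 X) C1)"
      using k kX q E by (intro circuit_sym_diff[OF c3 C12(1), of k q]) auto
    moreover have "sym_diff (sym_diff C2 X) C1 = D - X" using X unfolding D_def by blast
    ultimately show ?thesis by simp
  qed
qed

lemma circuit_C1_sym_diff:
  assumes X: "circuit M X" "X \<subseteq> D"
  shows "circuit M (sym_diff C1 X)"
proof -
  obtain p where p: "p \<in> X" "p \<in> C1" "p \<notin> C2" using D_meets[OF X] by blast
  obtain q where q: "q \<in> D - X" "q \<in> C2" "q \<notin> C1" using D_meets[OF circuit_D_Diff[OF X]] by blast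
  obtain k where "k \<in> C1" "k \<notin> X" using C12(4) X unfolding D_def by blast
  then show ?thesis
    using p q C12(5) by (intro circuit_sym_diff[OF C12(1) X(1), of p q]) auto
qed

lemma D2: "circuit M (D - D1)"
  using circuit_D_Diff[OF D1] .

text \<open>A second pair with the same intersection and symmetric difference as \<open>C1\<close>
  and \<open>C2\<close>, to be used for circuits whose union with \<open>C1\<close> or
  \<open>C2\<close> is the whole ground set.\<close>

definition "B1 = sym_diff C1 D1"
definition "B2 = sym_diff C1 (D - D1)"

lemma B12: "circuit M B1" "circuit M B2"
  unfolding B1_def B2_def using circuit_C1_sym_diff D1 D2 by auto

lemma B12_pair: "B1 \<inter> B2 = C1 \<inter> C2" "sym_diff B1 B2 = D"
  using D1(2) unfolding B1_def B2_def D_def by auto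

text \<open>Since \<open>c \<notin> D\<close>, the circuit \<open>C\<close> contains neither
  \<open>D1\<close> nor \<open>D - D1\<close>; let it miss \<open>u\<close> and \<open>v\<close>
  there. If \<open>C\<close> covers together with \<open>C1\<close> or \<open>C2\<close>, then
  \<open>u\<close> and \<open>v\<close> lie on the same side of the bad pair, and one of them is
  missed by \<open>B1\<close>, the other by \<open>B2\<close>.\<close>

lemma non_covering_pair:
  assumes C: "circuit M C" and c: "c \<in> C" "c \<in> C1 \<inter> C2"
  obtains A1 A2 where "circuit M A1" "circuit M A2" "A1 \<inter> A2 = C1 \<inter> C2" "sym_diff A1 A2 = D"
    "C \<union> A1 \<noteq> ground M" "C \<union> A2 \<noteq> ground M"
proof (cases "C \<union> C1 = ground M \<or> C \<union> C2 = ground M")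
  case True
  have "\<not> D1 \<subseteq> C" "\<not> D - D1 \<subseteq> C"
    using circuit_subset_eq[OF D1(1) C] circuit_subset_eq[OF D2 C] c D1(2) unfolding D_def by auto
  then obtain u v where u: "u \<in> D1" "u \<notin> C" and v: "v \<in> D - D1" "v \<notin> C" by blast
  have uv: "u \<in> ground M" "v \<in> ground M" using u v D1(2) C12(5) unfolding D_def by auto
  have "(u \<in> C1 \<and> v \<in> C1 \<and> u \<notin> C2 \<and> v \<notin> C2) \<or> (u \<notin> C1 \<and> v \<notin> C1 \<and> u \<in> C2 \<and> v \<in> C2)"
    using True u v uv D1(2) unfolding D_def by blast
  then have "(u \<notin> B1 \<and> v \<notin> B2) \<or> (v \<notin> B1 \<and> u \<notin> B2)"
    using u v unfolding B1_def B2_def by blast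
  then have "C \<union> B1 \<noteq> ground M" "C \<union> B2 \<noteq> ground M" using u v uv by blast+
  then show ?thesis using that[OF B12 B12_pair] by blast
next
  case False
  then show ?thesis using that[OF C12(1,2)] unfolding D_def by blast
qed

lemma common_subset_circuit:
  assumes C: "circuit M C" and c: "c \<in> C" "c \<in> C1 \<inter> C2"
  shows "C1 \<inter> C2 \<subseteq> C"
proof
  fix s assume s: "s \<in> C1 \<inter> C2"
  obtain A1 A2 where A: "circuit M A1" "circuit M A2" "A1 \<inter> A2 = C1 \<inter> C2" "sym_diff A1 A2 = D"
    "C \<union> A1 \<noteq> ground M" "C \<union> A2 \<noteq> ground M" using non_covering_pair[OF assms] .
  obtain a1 a2 where a: "a1 \<in> ground M" "a1 \<notin> C" "a1 \<notin> A1" "a2 \<in> ground M" "a2 \<notin> C" "a2 \<notin> A2"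
    using A circuit_ground[OF C] circuit_ground[OF A(1)] circuit_ground[OF A(2)] by blast
  have cA: "c \<in> A1" "c \<in> A2" and sA: "s \<in> A1" "s \<in> A2" and E: "c \<in> ground M" using A(3) c s C12(5) by auto
  show "s \<in> C"
  proof (rule ccontr)
    assume sC: "s \<notin> C"
    \<comment> \<open>Each sum shares \<open>c\<close> and misses \<open>a1\<close> or
      \<open>a2\<close>. The two resulting circuits share \<open>s\<close> and miss
      \<open>c\<close>, and \<open>C\<close> cancels from their symmetric difference, which leaves
      \<open>D\<close>.\<close>
    have F: "circuit M (sym_diff C A1)" "circuit M (sym_diff C A2)"
      using circuit_sym_diff[OF C A(1) _ c(1) cA(1) a(1,2,3)]
        circuit_sym_diff[OF C A(2) _ c(1) cA(2) a(4,5,6)] sA sC by blast+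
    have "A1 \<noteq> A2" using A(4) C12(3) unfolding D_def by blast
    then have "sym_diff C A1 \<noteq> sym_diff C A2" by blast
    then have "circuit M (sym_diff (sym_diff C A1) (sym_diff C A2))"
      using sA sC c(1) cA E by (intro circuit_sym_diff[OF F, of s c]) auto
    moreover have "sym_diff (sym_diff C A1) (sym_diff C A2) = D" using A(4) by blast
    ultimately show False using not_circuit_D by simp
  qed
qed

definition "e = (SOME x. x \<in> C1 \<inter> C2)"

lemma e: "C1 \<inter> C2 = {e}"
proof -
  have ein: "e \<in> C1 \<inter> C2" unfolding e_def using C12(4) some_in_eq[of "C1 \<inter> C2"] by simp
  moreover have "x = e" if x: "x \<in> C1 \<inter> C2" for x
  proof (rule ccontr)
    assume "x \<noteq> e"
    then obtain C where "circuit M C" "(x \<in> C) \<noteq> (e \<in> C)"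
      using separate x ein C12(5) unfolding circuits_separate_def by blast
    then show False using common_subset_circuit x ein by blast
  qed
  ultimately show ?thesis by blast
qed

lemma ground_e: "ground M - {e} = D" "e \<in> ground M" "e \<notin> D"
  using e C12(5) unfolding D_def by auto

text \<open>Off \<open>e\<close> this is \<open>circuit_D_Diff\<close>. For
  \<open>e \<in> C\<close>, \<open>D\<close> is written as \<open>A1 \<triangle> A2\<close> and the
  two circuits are added to \<open>C\<close> one after the other: \<open>C\<close> and
  \<open>A2\<close> share \<open>e\<close>; then \<open>u \<in> C - A2\<close> is shared and
  \<open>w \<in> C - A1\<close> is missed.\<close>

lemma circuit_sym_diff_D:
  assumes C: "circuit M C"
  shows "circuit M (sym_diff C D)"
proof (cases "e \<in> C")
  case False
  then have CD: "C \<subseteq> D" using circuit_ground[OF C] ground_e by blast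
  then have "sym_diff C D = D - C" by blast
  then show ?thesis using circuit_D_Diff[OF C CD] by simp
next
  case True
  obtain A1 A2 where A: "circuit M A1" "circuit M A2" "A1 \<inter> A2 = {e}" "sym_diff A1 A2 = D"
    "C \<union> A1 \<noteq> ground M" "C \<union> A2 \<noteq> ground M"
    using non_covering_pair[OF C True, unfolded e, OF singletonI] .
  have eA: "e \<in> A1" "e \<in> A2" using A(3) by auto
  show ?thesis
  proof (cases "C = A1 \<or> C = A2")
    case True
    then have "sym_diff C D = A1 \<or> sym_diff C D = A2" using A(4) by blast
    then show ?thesis using A by auto
  next
    case False
    obtain a where a: "a \<in> ground M" "a \<notin> C" "a \<notin> A2"
      using A circuit_ground[OF C] circuit_ground[OF A(2)] by blast
    have F: "circuit M (sym_diff C A2)" using circuit_sym_diff[OF C A(2) _ True eA(2) a] False by blast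
    obtain w where w: "w \<in> C" "w \<notin> A1" using False circuit_subset_eq[OF C A(1)] by blast
    obtain u where u: "u \<in> C" "u \<notin> A2" using False circuit_subset_eq[OF C A(2)] by blast
    have wu: "w \<in> ground M" "w \<in> D" "u \<in> D" using w u eA ground_e circuit_ground[OF C] by auto
    have "w \<in> A2" "u \<in> A1" using wu w u A(4) by auto
    then have "circuit M (sym_diff A1 (sym_diff C A2))"
      using w u wu eA True by (intro circuit_sym_diff[OF A(1) F, of u w]) auto
    moreover have "sym_diff A1 (sym_diff C A2) = sym_diff C D" using A(4) by blast
    ultimately show ?thesis by simp
  qed
qed

lemma circuit_meets_D:
  assumes C: "circuit M C"
  obtains x where "x \<in> C" "x \<in> D"
proof -
  have "\<not> C \<subseteq> {e}"
  proof
    assume "C \<subseteq> {e}"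
    then have "C \<subseteq> C1" "C \<subseteq> C2" using e by auto
    then show False using circuit_subset_eq[OF C] C12 by blast
  qed
  then show ?thesis using that circuit_ground[OF C] ground_e by blast
qed

text \<open>Disjoint circuits cannot be added directly. \<open>C\<close> and
  \<open>C' \<triangle> D\<close> do meet, and both miss any element of \<open>C'\<close>; adding
  them and then \<open>D\<close> would make \<open>C \<union> C'\<close> a circuit, although it
  properly contains \<open>C\<close>.\<close>

lemma disjoint_circuits_sym_diff:
  assumes C: "circuit M C" "circuit M C'" and disj: "C \<inter> C' = {}" and e': "e \<notin> C'"
  shows "sym_diff C C' = D"
proof (rule ccontr)
  assume neq: "sym_diff C C' \<noteq> D"
  have C'': "circuit M (sym_diff C' D)" using circuit_sym_diff_D[OF C(2)] .
  have neq': "C \<noteq> sym_diff C' D" using neq by blast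
  obtain x where x: "x \<in> C" "x \<in> D" using circuit_meets_D[OF C(1)] .
  obtain y where y: "y \<in> C'" using circuit_nonempty[OF M C(2)] by blast
  have yD: "y \<in> D" "y \<in> ground M" using y e' ground_e circuit_ground[OF C(2)] by auto
  have "circuit M (sym_diff C (sym_diff C' D))"
    using x y yD disj by (intro circuit_sym_diff[OF C(1) C'' neq', of x y]) auto
  then have "circuit M (sym_diff (sym_diff C (sym_diff C' D)) D)" by (rule circuit_sym_diff_D)
  moreover have "sym_diff (sym_diff C (sym_diff C' D)) D = C \<union> C'" using disj by blast
  ultimately have "circuit M (C \<union> C')" by simp
  then have "C = C \<union> C'" using circuit_subset_eq[OF C(1)] by blast
  then show False using y disj by blast
qed

text \<open>Again \<open>C'\<close> is replaced by \<open>C' \<triangle> D\<close>, which misses an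
  element of \<open>C' - C\<close>. A shared element is any \<open>u \<noteq> e\<close> in
  \<open>C - C'\<close>; if \<open>e \<notin> C'\<close>, it is found in the circuit
  \<open>D - C'\<close>, which \<open>C\<close> must contain by covering.\<close>

lemma covering_circuits_sym_diff:
  assumes C: "circuit M C" "circuit M C'" "C \<noteq> C'" and cov: "C \<union> C' = ground M" and e': "e \<in> C"
    and neq: "sym_diff C C' \<noteq> D"
  shows "circuit M (sym_diff C C')"
proof -
  have C'': "circuit M (sym_diff C' D)" using circuit_sym_diff_D[OF C(2)] .
  have neq': "C \<noteq> sym_diff C' D" using neq by blast
  obtain y where y: "y \<in> C'" "y \<notin> C" using circuit_subset_eq[OF C(2,1)] C(3) by blast
  have yD: "y \<in> D" "y \<in> ground M" using y e' ground_e circuit_ground[OF C(2)] by auto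
  have "\<exists>u. u \<in> C \<and> u \<notin> C' \<and> u \<noteq> e"
  proof (cases "e \<in> C'")
    case True
    then show ?thesis using circuit_subset_eq[OF C(1,2)] C(3) by blast
  next
    case False
    obtain v where v: "v \<in> sym_diff C' D" "v \<in> D" using circuit_meets_D[OF C''] .
    then have "v \<notin> C'" "v \<noteq> e" using False ground_e by auto
    moreover have "v \<in> C" using v cov ground_e \<open>v \<notin> C'\<close> by blast
    ultimately show ?thesis by blast
  qed
  then obtain u where u: "u \<in> C" "u \<notin> C'" "u \<noteq> e" by blast
  then have "u \<in> D" using circuit_ground[OF C(1)] ground_e by blast
  then have "circuit M (sym_diff C (sym_diff C' D))"
    using u y yD by (intro circuit_sym_diff[OF C(1) C'' neq', of u y]) auto
  then have "circuit M (sym_diff (sym_diff C (sym_diff C' D)) D)" by (rule circuit_sym_diff_D)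
  moreover have "sym_diff (sym_diff C (sym_diff C' D)) D = sym_diff C C'" by blast
  ultimately show ?thesis by simp
qed

lemma sym_diff_circuits:
  assumes C: "circuit M C" "circuit M C'" "C \<noteq> C'"
  shows "circuit M (sym_diff C C') \<or> sym_diff C C' = D"
proof -
  have comm: "sym_diff C C' = sym_diff C' C" by blast
  consider "C \<inter> C' = {}" | "C \<union> C' = ground M" | "C \<inter> C' \<noteq> {}" "C \<union> C' \<noteq> ground M" by blast
  then show ?thesis
  proof cases
    case 1
    then have "e \<notin> C \<or> e \<notin> C'" by blast
    then show ?thesis
      using disjoint_circuits_sym_diff[OF C(1,2)] disjoint_circuits_sym_diff[OF C(2,1)] 1 comm by (auto simp: Int_commute)
  next
    case 2
    then have "e \<in> C \<or> e \<in> C'" using ground_e by blast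
    then show ?thesis
      using covering_circuits_sym_diff[OF C(1,2)] covering_circuits_sym_diff[OF C(2,1)] 2 comm C(3)
      by (metis Un_commute)
  next
    case 3
    then show ?thesis using bad_covers[of C C'] C unfolding bad_pair_def by blast
  qed
qed

lemma almost_cycle_space: "almost_cycle_space M e ({C. circuit M C} \<union> {{}, D})"
proof -
  have cl: "sym_diff z w \<in> {C. circuit M C} \<union> {{}, D}"
    if zw: "z \<in> {C. circuit M C} \<union> {{}, D}" "w \<in> {C. circuit M C} \<union> {{}, D}" for z w
  proof (cases "z = {} \<or> w = {} \<or> z = w")
    case True
    then show ?thesis using zw by auto
  next
    case False
    have comm: "sym_diff D w = sym_diff w D" by blast
    consider "z = D" "circuit M w" | "w = D" "circuit M z" | "circuit M z" "circuit M w"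
      using False zw by blast
    then show ?thesis
    proof cases
      case 1
      then show ?thesis using circuit_sym_diff_D[of w] comm by simp
    next
      case 2
      then show ?thesis using circuit_sym_diff_D[of z] by simp
    next
      case 3
      then have "circuit M (sym_diff z w) \<or> sym_diff z w = D" using False sym_diff_circuits by blast
      then show ?thesis by blast
    qed
  qed
  have "D1 \<noteq> D" using D1(1) not_circuit_D by auto
  then have "D1 \<noteq> {}" "D1 \<subset> D" using D1 circuit_nonempty[OF M D1(1)] by auto
  moreover have "e \<in> C1" using e by auto
  moreover have "C \<noteq> {} \<and> C \<noteq> D" if "circuit M C" for C
    using circuit_nonempty[OF M that] not_circuit_D that by auto
  moreover have "\<exists>z\<in>{C. circuit M C} \<union> {{}, D}. (x \<in> z) \<noteq> (y \<in> z)"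
    if "x \<in> ground M" "y \<in> ground M" "x \<noteq> y" for x y
    using separate that unfolding circuits_separate_def by auto
  ultimately show ?thesis
    unfolding almost_cycle_space_def ground_e
    using cl ground_e(2) D1(1) C12(1) by (intro conjI) (simp_all, metis+)
qed

end

section \<open>The uniform case\<close>

definition uniform_corank_2 :: "'a matroid \<Rightarrow> nat \<Rightarrow> bool" where
  "uniform_corank_2 M n \<longleftrightarrow> finite (ground M) \<and> card (ground M) = n + 2 \<and>
     (\<forall>I\<subseteq>ground M. I \<in> indep_sets M \<longleftrightarrow> card I \<le> n)"

lemma isomorphic_uniform_iff: "isomorphic M (uniform n (n + 2)) \<longleftrightarrow> uniform_corank_2 M n"
proof
  assume "isomorphic M (uniform n (n + 2))"
  then obtain f where f: "bij_betw f (ground M) {..<n+2}"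
    "\<And>I. I \<subseteq> ground M \<Longrightarrow> I \<in> indep_sets M \<longleftrightarrow> f ` I \<subseteq> {..<n+2} \<and> card (f ` I) \<le> n"
    unfolding isomorphic_def uniform_def by auto
  have "f ` I \<subseteq> {..<n+2}" "card (f ` I) = card I" if "I \<subseteq> ground M" for I
    using f(1) that bij_betw_imp_surj_on[OF f(1)] card_image[of f I] inj_on_subset[OF bij_betw_imp_inj_on[OF f(1)] that]
    by blast+
  then show "uniform_corank_2 M n"
    unfolding uniform_corank_2_def using f bij_betw_finite[OF f(1)] bij_betw_same_card[OF f(1)] by auto
next
  assume u: "uniform_corank_2 M n"
  then obtain f where f: "bij_betw f (ground M) {..<n+2}"
    using ex_bij_betw_finite_nat[of "ground M"] unfolding uniform_corank_2_def atLeast0LessThan by auto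
  have "f ` I \<subseteq> {..<n+2}" "card (f ` I) = card I" if "I \<subseteq> ground M" for I
    using f(1) that bij_betw_imp_surj_on[OF f(1)] card_image[of f I] inj_on_subset[OF bij_betw_imp_inj_on[OF f(1)] that]
    by blast+
  then show "isomorphic M (uniform n (n + 2))"
    unfolding isomorphic_def uniform_def using f u unfolding uniform_corank_2_def
    by (intro exI[of _ f]) simp
qed

text \<open>Separation turns covering into sharp information: a circuit separating two elements
  outside a given circuit would miss one of them and so not cover with it. Applied to
  \<open>C1\<close>, and to every circuit once all pairs are known to cover, this shows that each
  circuit omits exactly one element.\<close>

lemma (in covering_bad_pair) uniform_if_all_cover_C1:
  assumes all: "\<And>C. circuit M C \<Longrightarrow> C \<noteq> C1 \<Longrightarrow> C \<union> C1 = ground M"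
  obtains n where "n \<ge> 2" "uniform_corank_2 M n"
proof -
  let ?E = "ground M"
  have fin: "finite ?E" using matroid_finite[OF M] .
  have sep: "\<exists>C. circuit M C \<and> (u \<in> C) \<noteq> (v \<in> C)" if "u \<in> ?E" "v \<in> ?E" "u \<noteq> v" for u v
    using separate that unfolding circuits_separate_def by blast
  obtain x where x: "x \<in> C2" "x \<notin> C1" using circuit_subset_eq[OF C12(2,1)] C12(3) by auto
  have xE: "x \<in> ?E" using x C12(5) by blast
  have C1: "C1 = ?E - {x}"
  proof -
    have "u = x" if u: "u \<in> ?E" "u \<notin> C1" for u
    proof (rule ccontr)
      assume "u \<noteq> x"
      then obtain C where C: "circuit M C" "(u \<in> C) \<noteq> (x \<in> C)" using sep u xE by blast
      then have "C \<noteq> C1" using u x by blast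
      then show False using all[OF C(1)] C(2) u x xE by blast
    qed
    then show ?thesis using circuit_ground[OF C12(1)] x by blast
  qed
  have cover: "A \<union> B = ?E" if AB: "circuit M A" "circuit M B" "A \<noteq> B" for A B
  proof (cases "A = C1 \<or> B = C1")
    case True
    then show ?thesis using all[OF AB(1)] all[OF AB(2)] AB(3) by blast
  next
    case False
    then have xin: "x \<in> A" "x \<in> B" using all[OF AB(1)] all[OF AB(2)] x xE by blast+
    \<comment> \<open>Eliminating \<open>x\<close> leaves only \<open>C1\<close> as a possible
      circuit, since all others contain \<open>x\<close>. Hence \<open>A \<union> B\<close> contains
      \<open>C1\<close> and \<open>x\<close>.\<close>
    obtain C where C: "circuit M C" "C \<subseteq> A \<union> B - {x}"
      using circuit_elimination[OF M AB, of x] xin by blast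
    have "C = C1" using all[OF C(1)] C(2) x xE by blast
    then show ?thesis using C C1 xin circuit_ground[OF AB(1)] circuit_ground[OF AB(2)] by blast
  qed
  have circ: "\<exists>z\<in>?E. A = ?E - {z}" if A: "circuit M A" for A
  proof -
    have "\<not> C1 \<subset> A" using circuit_subset_eq[OF C12(1) A] by blast
    then obtain z where z: "z \<in> ?E" "z \<notin> A" using C1 circuit_ground[OF A] xE by blast
    have "w = z" if w: "w \<in> ?E" "w \<notin> A" for w
    proof (rule ccontr)
      assume "w \<noteq> z"
      then obtain B where B: "circuit M B" "(w \<in> B) \<noteq> (z \<in> B)" using sep w z by blast
      then have "A \<noteq> B" using w z by blast
      then show False using cover[OF A B(1)] B(2) w z by blast
    qed
    then show ?thesis using z circuit_ground[OF A] by blast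
  qed
  have circ': "circuit M (?E - {z})" if z: "z \<in> ?E" for z
  proof (cases "z \<in> C1 \<inter> C2")
    case True
    obtain C where C: "circuit M C" "C \<subseteq> C1 \<union> C2 - {z}"
      using circuit_elimination[OF M C12(1-3) True] .
    then obtain w where "w \<in> ?E" "C = ?E - {w}" using circ by blast
    then have "w = z" using z C by blast
    then show ?thesis using C \<open>C = ?E - {w}\<close> by blast
  next
    case False
    then obtain A where A: "circuit M A" "z \<notin> A" using C12 by blast
    then obtain w where "w \<in> ?E" "A = ?E - {w}" using circ by blast
    then have "w = z" using z A by blast
    then show ?thesis using A \<open>A = ?E - {w}\<close> by blast
  qed
  obtain y where y: "y \<in> ?E" "C2 = ?E - {y}" using circ C12(2) by blast
  have xy: "x \<noteq> y" using x y by blast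
  obtain k where k: "k \<in> ?E" "k \<noteq> x" "k \<noteq> y" using C12(4) C1 y by blast
  \<comment> \<open>On three elements \<open>D\<close> would be the complement of \<open>k\<close>,
    thus a circuit. The fourth element is what gives \<open>n \<ge> 2\<close>.\<close>
  have "?E \<noteq> {x,y,k}"
  proof
    assume "?E = {x,y,k}"
    then have "?E - {k} = sym_diff C1 C2" unfolding C1 y(2) using k xy by blast
    then show False using circ'[OF k(1)] not_circuit_D unfolding D_def by simp
  qed
  then obtain l where l: "l \<in> ?E" "l \<notin> {x,y,k}" using xE y(1) k(1) by blast
  have "card {x,y,k,l} \<le> card ?E" using l k xE y(1) fin by (intro card_mono) auto
  moreover have "card {x,y,k,l} = 4" using l k xy by auto
  ultimately have card4: "card ?E \<ge> 4" by simp
  have "I \<in> indep_sets M \<longleftrightarrow> card I \<le> card ?E - 2" if I: "I \<subseteq> ?E" for I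
  proof -
    have finI: "finite I" using I fin finite_subset by blast
    have "I \<notin> indep_sets M \<longleftrightarrow> (\<exists>z\<in>?E. ?E - {z} \<subseteq> I)"
      unfolding indep_iff_no_circuit[OF M I] using circ circ' by metis
    also have "\<dots> \<longleftrightarrow> card (?E - I) \<le> 1"
    proof
      assume "\<exists>z\<in>?E. ?E - {z} \<subseteq> I"
      then obtain z where "?E - I \<subseteq> {z}" by blast
      then show "card (?E - I) \<le> 1" using card_mono[of "{z}" "?E - I"] by simp
    next
      assume "card (?E - I) \<le> 1"
      then have "card (?E - I) = 0 \<or> card (?E - I) = Suc 0" by linarith
      then have "?E - I = {} \<or> (\<exists>z. ?E - I = {z})" using fin by (simp add: card_1_singleton_iff)
      then show "\<exists>z\<in>?E. ?E - {z} \<subseteq> I" using xE by blast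
    qed
    also have "card (?E - I) = card ?E - card I" using I finI by (simp add: card_Diff_subset)
    finally show ?thesis using card4 card_mono[OF fin I] by linarith
  qed
  then have "uniform_corank_2 M (card ?E - 2)" unfolding uniform_corank_2_def using card4 fin by auto
  then show ?thesis using that[of "card ?E - 2"] card4 by simp
qed

text \<open>The circuits are the complements of single elements. Two of them have a symmetric
  difference of size two, which differs from the circuit size \<open>n + 1\<close> because
  \<open>n \<ge> 2\<close>.\<close>

lemma excluded_if_uniform_corank_2:
  assumes M: "is_matroid M" and n: "n \<ge> 2" and u: "uniform_corank_2 M n"
  shows "excluded_series_minor circuit_difference M"
proof -
  let ?E = "ground M"
  have fin: "finite ?E" and card: "card ?E = n + 2"
    and ind: "\<And>I. I \<subseteq> ?E \<Longrightarrow> I \<in> indep_sets M \<longleftrightarrow> card I \<le> n"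
    using u unfolding uniform_corank_2_def by auto
  have circ: "circuit M C \<longleftrightarrow> C \<subseteq> ?E \<and> card C = n + 1" for C
  proof
    assume C: "circuit M C"
    have CE: "C \<subseteq> ?E" using circuit_ground[OF C] .
    have dep: "\<not> card C \<le> n" using circuit_dependent[OF C] ind[OF CE] by simp
    then obtain c where c: "c \<in> C" by fastforce
    have "C - {c} \<subset> C" using c by blast
    then have "card (C - {c}) \<le> n" using circuit_psubset_indep[OF C] ind CE by blast
    then show "C \<subseteq> ?E \<and> card C = n + 1" using CE dep c finite_subset[OF CE fin] by auto
  next
    assume C: "C \<subseteq> ?E \<and> card C = n + 1"
    have "D \<in> indep_sets M" if "D \<subset> C" for D
      using psubset_card_mono[OF finite_subset[of C, OF _ fin] that] ind[of D] that C by auto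
    then show "circuit M C" unfolding circuit_def using C ind by auto
  qed
  have comp: "circuit M (?E - {x})" if "x \<in> ?E" for x
    unfolding circ using that fin card by auto
  have "\<not> card ?E \<le> Suc 0" using card by simp
  then obtain x y where xy: "x \<in> ?E" "y \<in> ?E" "x \<noteq> y" using card_le_Suc0_iff_eq[OF fin] by blast
  have "bad_pair M (?E - {x}) (?E - {y})"
    unfolding bad_pair_def
  proof (intro conjI)
    have "(?E - {x}) \<inter> (?E - {y}) = ?E - {x,y}" by blast
    moreover have "card (?E - {x,y}) = n" using xy fin card by (subst card_Diff_subset) auto
    ultimately show "(?E - {x}) \<inter> (?E - {y}) \<noteq> {}" using n by (metis card.empty not_numeral_le_zero)
    have "sym_diff (?E - {x}) (?E - {y}) = {x,y}" using xy by blast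
    then show "\<not> circuit M (sym_diff (?E - {x}) (?E - {y}))" unfolding circ using xy n by simp
  qed (use comp xy in auto)
  moreover have "C1 \<union> C2 = ?E" if bad: "bad_pair M C1 C2" for C1 C2
  proof -
    have C: "C1 \<subseteq> ?E" "C2 \<subseteq> ?E" "card C1 = n + 1" "card C2 = n + 1" "C1 \<noteq> C2"
      using bad unfolding bad_pair_def circ by auto
    then have "\<not> C2 \<subseteq> C1" using card_subset_eq[of C1 C2] finite_subset[OF C(1) fin] by auto
    then have "C1 \<subset> C1 \<union> C2" by blast
    then have "card C1 < card (C1 \<union> C2)" using C fin by (intro psubset_card_mono) (auto intro: finite_subset)
    then show ?thesis using C card fin by (intro card_seteq) auto
  qed
  moreover have "circuits_separate M"
    unfolding circuits_separate_def
  proof (intro ballI impI)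
    fix u v assume "u \<in> ?E" "v \<in> ?E" "u \<noteq> v"
    then show "\<exists>C. circuit M C \<and> (u \<in> C) \<noteq> (v \<in> C)" using comp[of u] by blast
  qed
  ultimately show ?thesis unfolding excluded_series_minor_iff[OF M] by blast
qed

text \<open>A member \<open>c\<close> through \<open>e\<close> and \<open>c \<triangle> D\<close>
  form a bad pair, as their sum is \<open>D\<close>. Every bad pair has sum \<open>D\<close>, so its
  circuits can only meet in \<open>e\<close>, and their union is everything.\<close>

lemma excluded_if_almost_cycle_space:
  assumes M: "is_matroid M" and Z: "almost_cycle_space M e Z"
  shows "excluded_series_minor circuit_difference M"
proof -
  let ?D = "ground M - {e}"
  have eE: "e \<in> ground M" and D: "?D \<in> Z" and cl: "\<And>z w. z \<in> Z \<Longrightarrow> w \<in> Z \<Longrightarrow> sym_diff z w \<in> Z"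
    and circ: "\<And>C. circuit M C \<longleftrightarrow> C \<in> Z \<and> C \<noteq> {} \<and> C \<noteq> ?D"
    and ez: "\<exists>z\<in>Z. e \<in> z" and small: "\<exists>z\<in>Z. z \<noteq> {} \<and> z \<subset> ?D"
    and sep: "\<And>x y. x \<in> ground M \<Longrightarrow> y \<in> ground M \<Longrightarrow> x \<noteq> y \<Longrightarrow> \<exists>z\<in>Z. (x \<in> z) \<noteq> (y \<in> z)"
    using Z unfolding almost_cycle_space_def by auto
  obtain c where c: "c \<in> Z" "e \<in> c" using ez by blast
  have c': "sym_diff c ?D \<in> Z" using cl[OF c(1) D] .
  have cc: "circuit M c" "circuit M (sym_diff c ?D)"
    unfolding circ using c c' by auto
  have "bad_pair M c (sym_diff c ?D)"
    unfolding bad_pair_def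
  proof (intro conjI)
    show "c \<noteq> sym_diff c ?D" using small by blast
    show "c \<inter> sym_diff c ?D \<noteq> {}" using c by blast
    have "sym_diff c (sym_diff c ?D) = ?D" by blast
    then show "\<not> circuit M (sym_diff c (sym_diff c ?D))" unfolding circ by simp
  qed (use cc in auto)
  moreover have "C1 \<union> C2 = ground M" if bad: "bad_pair M C1 C2" for C1 C2
  proof -
    have "C1 \<in> Z" "C2 \<in> Z" using bad_pair_circuits[OF bad] circ by auto
    then have "sym_diff C1 C2 \<in> Z" using cl by blast
    moreover have "sym_diff C1 C2 \<noteq> {}" "\<not> circuit M (sym_diff C1 C2)" "C1 \<inter> C2 \<noteq> {}"
      using bad unfolding bad_pair_def by auto
    ultimately have "sym_diff C1 C2 = ?D" "C1 \<inter> C2 \<noteq> {}" using circ by auto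
    then show ?thesis
      using circuit_ground[OF bad_pair_circuits(1)[OF bad]] circuit_ground[OF bad_pair_circuits(2)[OF bad]]
      by blast
  qed
  moreover have "circuits_separate M"
    unfolding circuits_separate_def
  proof (intro ballI impI)
    fix x y assume xy: "x \<in> ground M" "y \<in> ground M" "x \<noteq> y"
    then obtain z where z: "z \<in> Z" "(x \<in> z) \<noteq> (y \<in> z)" using sep by blast
    show "\<exists>C. circuit M C \<and> (x \<in> C) \<noteq> (y \<in> C)"
    proof (cases "z = ?D")
      \<comment> \<open>\<open>D\<close> is not a circuit, but when it separates \<open>x\<close>
        from \<open>y\<close>, exactly one of the circuits \<open>c\<close> and
        \<open>c \<triangle> D\<close> does so too.\<close>
      case True
      then have "(x \<in> c) \<noteq> (y \<in> c) \<or> (x \<in> sym_diff c ?D) \<noteq> (y \<in> sym_diff c ?D)"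
        using xy z c by auto
      then show ?thesis using cc by blast
    next
      case False
      then have "circuit M z" unfolding circ using z by auto
      then show ?thesis using z by blast
    qed
  qed
  ultimately show ?thesis unfolding excluded_series_minor_iff[OF M] by blast
qed

theorem excluded_iff_uniform_or_almost_cycle_space:
  assumes M: "is_matroid M"
  shows "excluded_series_minor circuit_difference M \<longleftrightarrow>
    (\<exists>n\<ge>2. isomorphic M (uniform n (n + 2))) \<or> (\<exists>e Z. almost_cycle_space M e Z)"
    (is "?L \<longleftrightarrow> ?R")
proof
  assume ?L
  then obtain C1 C2 where bad: "bad_pair M C1 C2" "\<And>C C'. bad_pair M C C' \<Longrightarrow> C \<union> C' = ground M"
    "circuits_separate M"
    unfolding excluded_series_minor_iff[OF M] by blast
  interpret covering_bad_pair M C1 C2 using M bad by unfold_locales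
  show ?R
  proof (cases "\<forall>C. circuit M C \<longrightarrow> C \<noteq> C1 \<longrightarrow> C \<union> C1 = ground M")
    case True
    then show ?thesis using uniform_if_all_cover_C1 isomorphic_uniform_iff by metis
  next
    case False
    then obtain D1 where D1: "circuit M D1" "D1 \<subseteq> D" using circuit_in_D by blast
    interpret bad_pair_with_circuit M C1 C2 D1 using D1 by unfold_locales
    show ?thesis using almost_cycle_space by blast
  qed
next
  assume ?R
  then show ?L
    using excluded_if_uniform_corank_2[OF M] excluded_if_almost_cycle_space[OF M] isomorphic_uniform_iff by metis
qed

section \<open>Parity duality\<close>

lemma even_card_Int_sym_diff:
  assumes "finite J"
  shows "even (card (J \<inter> sym_diff A B)) \<longleftrightarrow> (even (card (J \<inter> A)) \<longleftrightarrow> even (card (J \<inter> B)))"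
proof -
  have "card (J \<inter> A) = card (J \<inter> (A - B)) + card (J \<inter> (A \<inter> B))"
    using assms by (subst card_Un_disjoint[symmetric]) (auto intro: arg_cong[of _ _ card])
  moreover have "card (J \<inter> B) = card (J \<inter> (B - A)) + card (J \<inter> (A \<inter> B))"
    using assms by (subst card_Un_disjoint[symmetric]) (auto intro: arg_cong[of _ _ card])
  moreover have "card (J \<inter> sym_diff A B) = card (J \<inter> (A - B)) + card (J \<inter> (B - A))"
    using assms by (subst card_Un_disjoint[symmetric]) (auto intro: arg_cong[of _ _ card])
  ultimately show ?thesis by auto
qed

text \<open>Linear duality over GF(2): a set \<open>J\<close> as below is a linear dependency among the coordinate
  functionals of the space \<open>Z\<close>.\<close>

lemma isolating_member_or_orthogonal_subset:
  assumes "finite I" "f \<in> I" and "\<And>z w. z \<in> Z \<Longrightarrow> w \<in> Z \<Longrightarrow> sym_diff z w \<in> Z"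
  shows "(\<exists>z\<in>Z. z \<inter> I = {f}) \<or> (\<exists>J\<subseteq>I. f \<in> J \<and> (\<forall>z\<in>Z. even (card (J \<inter> z))))"
proof -
  have "(\<exists>z\<in>Z. z \<inter> insert f K = {f}) \<or> (\<exists>J\<subseteq>insert f K. f \<in> J \<and> (\<forall>z\<in>Z. even (card (J \<inter> z))))"
    if "finite K" "f \<notin> K" for K
    using that assms(3)
  proof (induction K arbitrary: Z rule: finite_induct)
    case empty
    show ?case
    proof (cases "\<exists>z\<in>Z. f \<in> z")
      case False
      then have "\<forall>z\<in>Z. even (card ({f} \<inter> z))" by auto
      then show ?thesis by blast
    qed auto
  next
    case (insert g K)
    \<comment> \<open>Any two members through \<open>g\<close> differ by a member of
      \<open>?Zg\<close>, so the parity of \<open>card (J \<inter> z)\<close> is the same for all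
      \<open>z\<close> through \<open>g\<close>. If it is odd, inserting \<open>g\<close> into
      \<open>J\<close> corrects it without affecting \<open>?Zg\<close>.\<close>
    let ?Zg = "{z\<in>Z. g \<notin> z}"
    have fg: "f \<noteq> g" using insert.prems by blast
    have "(\<exists>z\<in>?Zg. z \<inter> insert f K = {f}) \<or> (\<exists>J\<subseteq>insert f K. f \<in> J \<and> (\<forall>z\<in>?Zg. even (card (J \<inter> z))))"
      using insert.prems by (intro insert.IH) auto
    then show ?case
    proof (elim disjE bexE exE conjE)
      fix z assume "z \<in> ?Zg" "z \<inter> insert f K = {f}"
      then have "z \<in> Z" "z \<inter> insert f (insert g K) = {f}" by auto
      then show ?thesis by blast
    next
      fix J assume J: "J \<subseteq> insert f K" "f \<in> J" "\<forall>z\<in>?Zg. even (card (J \<inter> z))"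
      have finJ: "finite J" using J(1) insert.hyps(1) finite_subset by blast
      have gJ: "g \<notin> J" using J(1) fg insert.hyps by blast
      show ?thesis
      proof (cases "\<exists>z0\<in>Z. g \<in> z0")
        case False
        then have "\<forall>z\<in>Z. even (card (J \<inter> z))" using J(3) by blast
        then show ?thesis using J by blast
      next
        case True
        then obtain z0 where z0: "z0 \<in> Z" "g \<in> z0" by blast
        have par: "even (card (J \<inter> z)) \<longleftrightarrow> g \<notin> z \<or> even (card (J \<inter> z0))" if "z \<in> Z" for z
        proof (cases "g \<in> z")
          case True
          then have "sym_diff z z0 \<in> ?Zg" using z0 that insert.prems(2) by blast
          then have "even (card (J \<inter> sym_diff z z0))" using J(3) by blast
          then show ?thesis using even_card_Int_sym_diff[OF finJ, of z z0] True by simp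
        qed (use that J(3) in blast)
        show ?thesis
        proof (cases "even (card (J \<inter> z0))")
          case True
          then have "\<forall>z\<in>Z. even (card (J \<inter> z))" using par by blast
          then show ?thesis using J by blast
        next
          case False
          have "even (card (insert g J \<inter> z))" if "z \<in> Z" for z
            using par[OF that] False finJ gJ by (cases "g \<in> z") (auto simp: Int_insert_left)
          then have "insert g J \<subseteq> insert f (insert g K) \<and> f \<in> insert g J \<and> (\<forall>z\<in>Z. even (card (insert g J \<inter> z)))"
            using J by blast
          then show ?thesis by blast
        qed
      qed
    qed
  qed
  from this[of "I - {f}"] show ?thesis using assms(1,2) by (simp add: insert_absorb)
qed

text \<open>Linear independence over GF(2) of the functionals \<open>z \<mapsto> (x \<in> z)\<close>
  on \<open>Z\<close>, for \<open>x\<close> in \<open>I\<close>: a nonempty \<open>J\<close> that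
  meets all members evenly is a linear relation among them.\<close>

definition parity_indep :: "'a set set \<Rightarrow> 'a set \<Rightarrow> bool" where
  "parity_indep Z I \<longleftrightarrow> (\<forall>J\<subseteq>I. J \<noteq> {} \<longrightarrow> (\<exists>z\<in>Z. odd (card (J \<inter> z))))"

lemma isolating_member:
  assumes "parity_indep Z I" "finite I" "f \<in> I" "\<And>z w. z \<in> Z \<Longrightarrow> w \<in> Z \<Longrightarrow> sym_diff z w \<in> Z"
  obtains z where "z \<in> Z" "z \<inter> I = {f}"
  using isolating_member_or_orthogonal_subset[OF assms(2,3,4)] assms(1) that
  unfolding parity_indep_def by blast

text \<open>The assumption \<open>dep\<close> says that \<open>M\<close> is binary with cycle space
  \<open>Z\<close>. If a basis \<open>B\<close> avoids \<open>I\<close>, then for each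
  \<open>f \<in> I\<close> a member inside \<open>insert f B\<close> meets \<open>I\<close> only in
  \<open>f\<close>, so no relation contains \<open>f\<close>. Conversely, isolating members show
  that the complement of \<open>I\<close> already has full rank.\<close>

lemma dual_indep_iff_parity_indep:
  assumes M: "is_matroid M" and cl: "\<And>z w. z \<in> Z \<Longrightarrow> w \<in> Z \<Longrightarrow> sym_diff z w \<in> Z"
    and ZE: "\<And>z. z \<in> Z \<Longrightarrow> z \<subseteq> ground M"
    and dep: "\<And>D. D \<subseteq> ground M \<Longrightarrow> D \<notin> indep_sets M \<longleftrightarrow> (\<exists>z\<in>Z. z \<noteq> {} \<and> z \<subseteq> D)"
    and IE: "I \<subseteq> ground M"
  shows "I \<in> indep_sets (dual M) \<longleftrightarrow> parity_indep Z I"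
proof
  assume "I \<in> indep_sets (dual M)"
  then obtain B where B: "basis M B" "I \<subseteq> ground M - B" unfolding dual_indep_iff by blast
  show "parity_indep Z I"
    unfolding parity_indep_def
  proof (intro allI impI)
    fix J assume J: "J \<subseteq> I" "J \<noteq> {}"
    then obtain f where f: "f \<in> J" by blast
    have "insert f B \<notin> indep_sets M" using basis_maximal[OF B(1)] B(2) f J by blast
    then obtain z where z: "z \<in> Z" "z \<noteq> {}" "z \<subseteq> insert f B"
      using dep[of "insert f B"] basis_ground[OF M B(1)] f J IE by blast
    have "f \<in> z" using dep[OF basis_ground[OF M B(1)]] basis_indep[OF B(1)] z by blast
    then have "J \<inter> z = {f}" using z B J f by blast
    then have "odd (card (J \<inter> z))" by simp
    then show "\<exists>z\<in>Z. odd (card (J \<inter> z))" using z(1) by blast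
  qed
next
  assume par: "parity_indep Z I"
  let ?E = "ground M"
  have fin: "finite ?E" using matroid_finite[OF M] .
  obtain B where B: "B \<subseteq> ?E - I" "B \<in> indep_sets M"
      "\<And>J. J \<in> indep_sets M \<Longrightarrow> J \<subseteq> ?E - I \<Longrightarrow> card J \<le> card B"
    using indep_extend_within[OF M indep_empty[OF M] empty_subsetI Diff_subset[of ?E I]] by metis
  have finB: "finite B" using indep_finite[OF M B(2)] .
  obtain B' where B': "B \<subseteq> B'" "basis M B'" using basis_extends[OF M B(2)] .
  have "B' \<subseteq> B"
  proof
    fix f assume f: "f \<in> B'"
    show "f \<in> B"
    proof (rule ccontr)
      assume fB: "f \<notin> B"
      have fBi: "insert f B \<in> indep_sets M" using indep_mono[OF M basis_indep[OF B'(2)]] f B' by blast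
      have "f \<in> I"
      proof (rule ccontr)
        assume "f \<notin> I"
        then have "insert f B \<subseteq> ?E - I" using indep_ground[OF M fBi] B(1) by blast
        then show False using B(3)[OF fBi] fB finB by simp
      qed
      then obtain z0 where "z0 \<in> Z" "z0 \<inter> I = {f}"
        using isolating_member[OF par finite_subset[OF IE fin] _ cl, of f] by blast
      \<comment> \<open>Minimality makes \<open>z - {f}\<close> independent, since a member inside
        it could be subtracted from \<open>z\<close>. Hence \<open>z - {f}\<close> extends to a
        largest independent set \<open>B2\<close> off \<open>I\<close>, to which
        \<open>insert f B\<close> can contribute neither \<open>f\<close> nor an element off
        \<open>I\<close>.\<close>
      then obtain z where z: "z \<in> Z" "z \<inter> I = {f}"
        and zmin: "\<And>w. w \<in> Z \<Longrightarrow> w \<inter> I = {f} \<Longrightarrow> card z \<le> card w"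
        using ex_has_least_nat[of "\<lambda>z. z \<in> Z \<and> z \<inter> I = {f}" z0 card] by blast
      have finz: "finite z" using ZE[OF z(1)] fin finite_subset by blast
      have zi: "z - {f} \<in> indep_sets M"
      proof (rule ccontr)
        assume "\<not> ?thesis"
        then obtain w where w: "w \<in> Z" "w \<noteq> {}" "w \<subseteq> z - {f}" using dep[of "z - {f}"] ZE[OF z(1)] by blast
        then have "sym_diff z w = z - w" by blast
        then have "z - w \<in> Z" using cl[OF z(1) w(1)] by metis
        moreover have "(z - w) \<inter> I = {f}" using z w by blast
        ultimately have "card z \<le> card (z - w)" using zmin by blast
        moreover have "card (z - w) < card z" using w finz by (intro psubset_card_mono) auto
        ultimately show False by simp
      qed
      have zI: "z - {f} \<subseteq> ?E - I" using z ZE by blast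
      obtain B2 where B2: "z - {f} \<subseteq> B2" "B2 \<subseteq> ?E - I" "B2 \<in> indep_sets M"
        "\<And>J. J \<in> indep_sets M \<Longrightarrow> J \<subseteq> ?E - I \<Longrightarrow> card J \<le> card B2"
        using indep_extend_within[OF M zi zI Diff_subset] by blast
      have "card B2 < card (insert f B)" using B(3)[OF B2(3,2)] fB finB by simp
      then obtain x where x: "x \<in> insert f B - B2" "insert x B2 \<in> indep_sets M"
        using indep_augment[OF M B2(3) fBi] by blast
      show False
      proof (cases "x = f")
        case True
        then have "z \<subseteq> insert x B2" using B2(1) by blast
        moreover have "z \<noteq> {}" using z(2) by auto
        ultimately show False using dep[OF indep_ground[OF M x(2)]] x(2) z(1) by blast
      next
        case False
        then have "insert x B2 \<subseteq> ?E - I" using x(1) B(1) B2(2) by blast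
        then have "card (insert x B2) \<le> card B2" using B2(4)[OF x(2)] by blast
        then show False using x indep_finite[OF M B2(3)] by simp
      qed
    qed
  qed
  then have "basis M B" using B' by auto
  then show "I \<in> indep_sets (dual M)" unfolding dual_indep_iff using B IE by blast
qed

text \<open>The way back: a representation of the dual determines the dependent sets of
  \<open>M\<close>. A linear relation and a member of \<open>Z\<close> cannot meet in exactly one
  element; both directions produce such a meeting.\<close>

lemma dependent_iff_contains_member:
  assumes M: "is_matroid M" and cl: "\<And>z w. z \<in> Z \<Longrightarrow> w \<in> Z \<Longrightarrow> sym_diff z w \<in> Z"
    and ZE: "\<And>z. z \<in> Z \<Longrightarrow> z \<subseteq> ground M"
    and par: "\<And>I. I \<subseteq> ground M \<Longrightarrow> I \<in> indep_sets (dual M) \<longleftrightarrow> parity_indep Z I"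
    and DE: "D \<subseteq> ground M"
  shows "D \<notin> indep_sets M \<longleftrightarrow> (\<exists>z\<in>Z. z \<noteq> {} \<and> z \<subseteq> D)"
proof
  assume "\<exists>z\<in>Z. z \<noteq> {} \<and> z \<subseteq> D"
  then obtain z f where z: "z \<in> Z" "z \<subseteq> D" "f \<in> z" by blast
  show "D \<notin> indep_sets M"
  proof
    assume "D \<in> indep_sets M"
    then obtain B where B: "D \<subseteq> B" "basis M B" using basis_extends[OF M] by blast
    let ?Bd = "ground M - B"
    have Bd: "basis (dual M) ?Bd" using basis_dual_iff[OF M] B basis_ground[OF M B(2)] by (simp add: double_diff)
    have "insert f ?Bd \<notin> indep_sets (dual M)" using basis_maximal[OF Bd] z B by blast
    then have "\<not> parity_indep Z (insert f ?Bd)" using par[of "insert f ?Bd"] z DE by blast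
    then obtain J where J: "J \<subseteq> insert f ?Bd" "J \<noteq> {}" "\<And>z. z \<in> Z \<Longrightarrow> even (card (J \<inter> z))"
      unfolding parity_indep_def by blast
    have "parity_indep Z ?Bd" using par basis_indep[OF Bd] by blast
    then have "f \<in> J" using J unfolding parity_indep_def by blast
    then have "J \<inter> z = {f}" using J z B by blast
    then show False using J(3)[OF z(1)] by simp
  qed
next
  assume dep: "D \<notin> indep_sets M"
  let ?E = "ground M"
  note Md = matroid_dual[OF M]
  obtain I where I: "I \<subseteq> ?E - D" "I \<in> indep_sets (dual M)"
      "\<And>J. J \<in> indep_sets (dual M) \<Longrightarrow> J \<subseteq> ?E - D \<Longrightarrow> card J \<le> card I"
    using indep_extend_within[OF Md indep_empty[OF Md], of "?E - D"] by auto
  have finI: "finite I" using indep_finite[OF Md I(2)] .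
  have max: "insert x I \<notin> indep_sets (dual M)" if "x \<in> ?E - D" "x \<notin> I" for x
    using I(3)[of "insert x I"] that I(1) finI by auto
  obtain B where B: "I \<subseteq> B" "basis (dual M) B" using basis_extends[OF Md I(2)] .
  have "B \<noteq> I"
  proof
    assume "B = I"
    then have "basis M (?E - I)" using B basis_dual_iff[OF M] by blast
    then show False using dep indep_mono[OF M basis_indep] I(1) DE by blast
  qed
  then obtain f where f: "f \<in> B" "f \<notin> I" using B by blast
  have ind: "insert f I \<in> indep_sets (dual M)" using indep_mono[OF Md basis_indep[OF B(2)]] f B by blast
  then have fD: "f \<in> D" using max f indep_ground[OF Md ind] by auto
  have "parity_indep Z (insert f I)" using par ind indep_ground[OF Md ind] by simp
  then obtain z where z: "z \<in> Z" "z \<inter> insert f I = {f}"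
    using isolating_member[OF _ _ _ cl, of "insert f I" f] finI by blast
  \<comment> \<open>For \<open>x\<close> in \<open>z - D\<close>, maximality of \<open>I\<close> off
    \<open>D\<close> gives a relation inside \<open>insert x I\<close>. It must contain
    \<open>x\<close>, and \<open>z\<close> avoids \<open>I\<close>, so it would meet
    \<open>z\<close> in \<open>x\<close> alone.\<close>
  have "z \<subseteq> D"
  proof
    fix x assume x: "x \<in> z"
    show "x \<in> D"
    proof (rule ccontr)
      assume xD: "x \<notin> D"
      have xI: "x \<in> ?E - D" "x \<notin> I" using xD x z(2) ZE[OF z(1)] fD by auto
      then have "\<not> parity_indep Z (insert x I)" using max[OF xI] par[of "insert x I"] I(1) by blast
      then obtain J where J: "J \<subseteq> insert x I" "J \<noteq> {}" "\<And>z. z \<in> Z \<Longrightarrow> even (card (J \<inter> z))"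
        unfolding parity_indep_def by blast
      have "parity_indep Z I" using par I(1,2) by blast
      then have "x \<in> J" using J unfolding parity_indep_def by blast
      moreover have "z \<inter> I = {}" using z(2) f(2) by auto
      ultimately have "J \<inter> z = {x}" using J(1) x by blast
      then show False using J(3)[OF z(1)] by simp
    qed
  qed
  then show "\<exists>z\<in>Z. z \<noteq> {} \<and> z \<subseteq> D" using z by blast
qed

section \<open>Vectors over GF(2)\<close>

text \<open>Addition and multiplication of bits are kept as ring operations, so that the lemmas on
  sums and vector spaces continue to match.\<close>

declare add_bit_eq_xor [simp del] mult_bit_eq_and [simp del]

lemma bit_add_self [simp]: "x + x = (0::bit)"
  by (cases x) simp_all

lemma bit_add_eq_0_iff [simp]: "x + y = (0::bit) \<longleftrightarrow> x = y"
  by (cases x; cases y) simp_all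

lemma bitvec_add_self [simp]: "v + v = (0::bitvec)"
  by (simp add: fun_eq_iff)

lemma bitvec_add_add_self [simp]: "u + v + v = (u::bitvec)" "u + (u + v) = (v::bitvec)"
  by (simp_all add: add.assoc add.assoc[symmetric, of u u])

lemma bitvec_add_eq_0_iff: "u + v = (0::bitvec) \<longleftrightarrow> u = v"
  by (simp add: fun_eq_iff)

lemma bitvec_scale_simps [simp]: "bitvec_scale 0 v = 0" "bitvec_scale 1 v = v"
  by (simp_all add: bitvec_scale_def fun_eq_iff)

lemma sum_fun_apply: "(\<Sum>x\<in>J. g x) i = (\<Sum>x\<in>J. g x i :: bit)"
  by (induction J rule: infinite_finite_induct) auto

lemma sum_bit_eq_0_iff:
  assumes "finite J"
  shows "(\<Sum>x\<in>J. g x) = (0::bit) \<longleftrightarrow> even (card {x\<in>J. g x = 1})"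
  using assms
proof (induction J rule: finite_induct)
  case (insert a J)
  have "{x \<in> insert a J. g x = 1} = (if g a = 1 then insert a {x\<in>J. g x = 1} else {x\<in>J. g x = 1})" by auto
  then show ?case using insert by (cases "g a"; cases "sum g J") auto
qed simp

lemma independent_iff_sum_nonzero:
  assumes "finite T"
  shows "bitvec.independent T \<longleftrightarrow> (\<forall>J\<subseteq>T. J \<noteq> {} \<longrightarrow> \<Sum>J \<noteq> 0)"
proof -
  have "bitvec.dependent T \<longleftrightarrow> (\<exists>J\<subseteq>T. J \<noteq> {} \<and> \<Sum>J = 0)"
    unfolding bitvec.dependent_finite[OF assms]
  proof
    assume "\<exists>u. (\<exists>v\<in>T. u v \<noteq> 0) \<and> (\<Sum>v\<in>T. bitvec_scale (u v) v) = 0"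
    then obtain u where u: "\<exists>v\<in>T. u v \<noteq> 0" "(\<Sum>v\<in>T. bitvec_scale (u v) v) = 0" by blast
    have "\<Sum>{v\<in>T. u v = 1} = (\<Sum>v\<in>T. bitvec_scale (u v) v)"
      using assms by (intro sum.mono_neutral_cong_left) auto
    then show "\<exists>J\<subseteq>T. J \<noteq> {} \<and> \<Sum>J = 0" using u by (intro exI[of _ "{v\<in>T. u v = 1}"]) auto
  next
    assume "\<exists>J\<subseteq>T. J \<noteq> {} \<and> \<Sum>J = 0"
    then obtain J where J: "J \<subseteq> T" "J \<noteq> {}" "\<Sum>J = 0" by blast
    have "(\<Sum>v\<in>T. bitvec_scale (if v \<in> J then 1 else 0) v) = \<Sum>J"
      using assms J(1) by (intro sum.mono_neutral_cong_right) auto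
    then show "\<exists>u. (\<exists>v\<in>T. u v \<noteq> 0) \<and> (\<Sum>v\<in>T. bitvec_scale (u v) v) = 0"
      using J by (intro exI[of _ "\<lambda>v. if v \<in> J then 1 else 0"]) auto
  qed
  then show ?thesis by blast
qed

lemma span_subset_sums:
  assumes "finite B"
  shows "bitvec.span B \<subseteq> (\<lambda>J. \<Sum>J) ` Pow B"
proof
  fix v assume "v \<in> bitvec.span B"
  then obtain u where v: "v = (\<Sum>b\<in>B. bitvec_scale (u b) b)"
    unfolding bitvec.span_finite[OF assms] by blast
  have "\<Sum>{b\<in>B. u b = 1} = v"
    unfolding v using assms by (intro sum.mono_neutral_cong_left) auto
  then show "v \<in> (\<lambda>J. \<Sum>J) ` Pow B" by blast
qed

lemma independent_image_iff:
  assumes "inj_on \<Phi> I" "finite I"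
  shows "bitvec.independent (\<Phi> ` I) \<longleftrightarrow> (\<forall>J\<subseteq>I. J \<noteq> {} \<longrightarrow> (\<Sum>x\<in>J. \<Phi> x) \<noteq> 0)"
proof -
  have "(\<forall>J\<subseteq>\<Phi> ` I. J \<noteq> {} \<longrightarrow> \<Sum>J \<noteq> 0) \<longleftrightarrow> (\<forall>J\<subseteq>I. J \<noteq> {} \<longrightarrow> \<Sum>(\<Phi> ` J) \<noteq> 0)"
    by (auto simp: subset_image_iff)
  moreover have "\<Sum>(\<Phi> ` J) = (\<Sum>x\<in>J. \<Phi> x)" if "J \<subseteq> I" for J
    using inj_on_subset[OF assms(1) that] by (simp add: sum.reindex)
  ultimately show ?thesis
    unfolding independent_iff_sum_nonzero[OF finite_imageI[OF assms(2)]] by auto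
qed

text \<open>Every linear functional on GF(2)^r is \<open>dot S\<close> for a unique
  \<open>S \<subseteq> {..<r}\<close>, so finite index sets stand for functionals and their
  symmetric difference for addition.\<close>

definition dot :: "nat set \<Rightarrow> bitvec \<Rightarrow> bit" where
  "dot S v = (\<Sum>i\<in>S. v i)"

lemma dot_empty [simp]: "dot {} v = 0"
  by (simp add: dot_def)

lemma dot_singleton [simp]: "dot {i} v = v i"
  by (simp add: dot_def)

lemma dot_insert: "finite S \<Longrightarrow> i \<notin> S \<Longrightarrow> dot (insert i S) v = v i + dot S v"
  by (simp add: dot_def)

lemma dot_zero [simp]: "dot S 0 = 0"
  by (simp add: dot_def)

lemma dot_add [simp]: "dot S (u + v) = dot S u + dot S v"
  by (simp add: dot_def sum.distrib)

lemma dot_sum: "dot S (\<Sum>x\<in>J. g x) = (\<Sum>x\<in>J. dot S (g x))"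
  by (induction J rule: infinite_finite_induct)
     (simp_all only: sum.infinite sum.empty sum.insert dot_zero dot_add not_False_eq_True)

lemma dot_sym_diff:
  assumes "finite S" "finite T"
  shows "dot (sym_diff S T) v = dot S v + dot T v"
proof -
  have "dot S v = dot (S - T) v + dot (S \<inter> T) v" "dot T v = dot (T - S) v + dot (S \<inter> T) v"
    unfolding dot_def using assms sum.Int_Diff[of S v T] sum.Int_Diff[of T v S]
    by (simp_all add: Int_commute add.commute)
  moreover have "dot (sym_diff S T) v = dot (S - T) v + dot (T - S) v"
    unfolding dot_def using assms by (intro sum.union_disjoint) auto
  ultimately show ?thesis by (simp add: ac_simps)
qed

lemma dot_flip: "finite S \<Longrightarrow> dot S (v(k := v k + 1)) = dot S v + (if k \<in> S then 1 else 0)"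
proof (induction S rule: finite_induct)
  case (insert i S)
  then show ?case by (auto simp: dot_insert ac_simps)
qed simp

lemma dot_cong: "(\<And>i. i \<in> S \<Longrightarrow> u i = v i) \<Longrightarrow> dot S u = dot S v"
  by (simp add: dot_def)

text \<open>For the matrix with columns \<open>\<Phi> x\<close>, these are the supports of the
  vectors in its row space. When \<open>\<Phi>\<close> represents the dual of a matroid, the row
  space is the cycle space of the matroid.\<close>

definition support :: "'a set \<Rightarrow> ('a \<Rightarrow> bitvec) \<Rightarrow> nat set \<Rightarrow> 'a set" where
  "support E \<Phi> S = {x\<in>E. dot S (\<Phi> x) = 1}"

lemma support_empty [simp]: "support E \<Phi> {} = {}"
  by (simp add: support_def)

lemma support_sym_diff:
  "finite S \<Longrightarrow> finite T \<Longrightarrow> support E \<Phi> (sym_diff S T) = sym_diff (support E \<Phi> S) (support E \<Phi> T)"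
proof -
  have "x + y = 1 \<longleftrightarrow> (x = 1) \<noteq> (y = 1)" for x y :: bit
    by (cases x; cases y) simp_all
  then show "finite S \<Longrightarrow> finite T \<Longrightarrow> support E \<Phi> (sym_diff S T) = sym_diff (support E \<Phi> S) (support E \<Phi> T)"
    unfolding support_def by (auto simp: dot_sym_diff)
qed

lemma supports_closed:
  assumes "z \<in> support E \<Phi> ` Pow {..<r}" "w \<in> support E \<Phi> ` Pow {..<r}"
  shows "sym_diff z w \<in> support E \<Phi> ` Pow {..<r}"
proof -
  obtain S T where ST: "S \<subseteq> {..<r}" "T \<subseteq> {..<r}" "z = support E \<Phi> S" "w = support E \<Phi> T" using assms by auto
  then have "sym_diff z w = support E \<Phi> (sym_diff S T)"
    using support_sym_diff[of S T E \<Phi>] finite_subset[OF ST(1)] finite_subset[OF ST(2)] by simp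
  moreover have "sym_diff S T \<in> Pow {..<r}" using ST by blast
  ultimately show ?thesis by blast
qed

text \<open>The value of \<open>dot S\<close> at the sum of \<open>\<Phi>\<close> over
  \<open>J\<close> is the parity of \<open>card (J \<inter> support E \<Phi> S)\<close>, and a
  vector is zero exactly when all functionals vanish on it.\<close>

lemma independent_image_iff_parity_indep:
  assumes inj: "inj_on \<Phi> I" and I: "finite I" "I \<subseteq> E" and r: "\<And>x i. x \<in> E \<Longrightarrow> i \<ge> r \<Longrightarrow> \<Phi> x i = 0"
  shows "bitvec.independent (\<Phi> ` I) \<longleftrightarrow> parity_indep (support E \<Phi> ` Pow {..<r}) I"
proof -
  have "(\<Sum>x\<in>J. \<Phi> x) \<noteq> 0 \<longleftrightarrow> (\<exists>z\<in>support E \<Phi> ` Pow {..<r}. odd (card (J \<inter> z)))" if J: "J \<subseteq> I" for J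
  proof -
    have finJ: "finite J" using J I finite_subset by blast
    have card: "odd (card (J \<inter> support E \<Phi> S)) \<longleftrightarrow> dot S (\<Sum>x\<in>J. \<Phi> x) \<noteq> 0" for S
    proof -
      have "J \<inter> support E \<Phi> S = {x\<in>J. dot S (\<Phi> x) = 1}" using J I unfolding support_def by auto
      then show ?thesis by (metis dot_sum sum_bit_eq_0_iff[OF finJ])
    qed
    have "(\<Sum>x\<in>J. \<Phi> x) \<noteq> 0 \<longleftrightarrow> (\<exists>S\<in>Pow {..<r}. dot S (\<Sum>x\<in>J. \<Phi> x) \<noteq> 0)"
    proof
      assume "(\<Sum>x\<in>J. \<Phi> x) \<noteq> 0"
      then obtain i where i: "(\<Sum>x\<in>J. \<Phi> x) i \<noteq> 0" by (auto simp: fun_eq_iff)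
      have "i < r"
      proof (rule ccontr)
        assume "\<not> i < r"
        then have "(\<Sum>x\<in>J. \<Phi> x i) = 0" using r J I by (intro sum.neutral) auto
        then show False using i by (simp add: sum_fun_apply)
      qed
      then show "\<exists>S\<in>Pow {..<r}. dot S (\<Sum>x\<in>J. \<Phi> x) \<noteq> 0" using i by (intro bexI[of _ "{i}"]) auto
    qed auto
    then show ?thesis using card by simp
  qed
  then show ?thesis unfolding independent_image_iff[OF inj I(1)] parity_indep_def by simp
qed

section \<open>Projective and affine geometries in coordinates\<close>

lemma ground_PG: "ground (PG d) = {v. v \<noteq> 0 \<and> (\<forall>i>d. v i = 0)}"
  by (simp add: PG_def Let_def)

lemma indep_PG_iff: "I \<in> indep_sets (PG d) \<longleftrightarrow> I \<subseteq> ground (PG d) \<and> bitvec.independent I"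
  by (simp add: PG_def Let_def)

lemma ground_AG: "ground (AG d) = {v. v 0 = 1 \<and> (\<forall>i>d. v i = 0)}"
  by (auto simp: AG_def hyperplane_at_infinity_def ground_PG)

lemma ground_AG_plus: "e \<in> hyperplane_at_infinity d \<Longrightarrow> ground (AG_plus d e) = insert e (ground (AG d))"
  unfolding AG_plus_def AG_def by (auto simp: hyperplane_at_infinity_def)

lemma indep_AG_iff: "I \<in> indep_sets (AG d) \<longleftrightarrow> I \<subseteq> ground (AG d) \<and> bitvec.independent I"
  unfolding AG_def delete_def by (auto simp: indep_PG_iff)

lemma indep_AG_plus_iff: "I \<in> indep_sets (AG_plus d e) \<longleftrightarrow> I \<subseteq> ground (AG_plus d e) \<and> bitvec.independent I"
  unfolding AG_plus_def delete_def by (auto simp: indep_PG_iff)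

lemma isomorphic_delete_AG_plus_iff:
  "isomorphic N (delete (AG_plus d e) X) \<longleftrightarrow>
    (\<exists>f. bij_betw f (ground N) (ground (AG_plus d e) - X) \<and>
      (\<forall>I\<subseteq>ground N. I \<in> indep_sets N \<longleftrightarrow> bitvec.independent (f ` I)))"
proof -
  have "f ` I \<in> indep_sets (delete (AG_plus d e) X) \<longleftrightarrow> bitvec.independent (f ` I)"
    if "bij_betw f (ground N) (ground (AG_plus d e) - X)" "I \<subseteq> ground N" for f I
  proof -
    have "f ` I \<subseteq> ground (AG_plus d e) - X" using that unfolding bij_betw_def by blast
    then show ?thesis unfolding delete_def by (auto simp: indep_AG_plus_iff)
  qed
  then show ?thesis unfolding isomorphic_def by auto
qed

lemma contains_copy_AG_iff:
  "contains_copy (restrict (AG d) X) (AG d') \<longleftrightarrow>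
    (\<exists>Y f. Y \<subseteq> X \<inter> ground (AG d) \<and> bij_betw f Y (ground (AG d')) \<and>
      (\<forall>I\<subseteq>Y. bitvec.independent I \<longleftrightarrow> bitvec.independent (f ` I)))"
proof -
  have *: "isomorphic (restrict (restrict (AG d) X) Y) (AG d') \<longleftrightarrow>
      (\<exists>f. bij_betw f Y (ground (AG d')) \<and> (\<forall>I\<subseteq>Y. bitvec.independent I \<longleftrightarrow> bitvec.independent (f ` I)))"
    if Y: "Y \<subseteq> X \<inter> ground (AG d)" for Y
  proof -
    have gr: "ground (restrict (restrict (AG d) X) Y) = Y" using Y by auto
    have ind: "I \<in> indep_sets (restrict (restrict (AG d) X) Y) \<longleftrightarrow> bitvec.independent I" if "I \<subseteq> Y" for I
      using that Y by (auto simp: indep_AG_iff)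
    have ind': "f ` I \<in> indep_sets (AG d') \<longleftrightarrow> bitvec.independent (f ` I)"
      if "bij_betw f Y (ground (AG d'))" "I \<subseteq> Y" for f I
      using that unfolding bij_betw_def indep_AG_iff by blast
    show ?thesis
      unfolding isomorphic_def gr by (intro arg_cong[of _ _ Ex] ext conj_cong refl)
        (simp del: indep_restrict_iff add: ind ind')
  qed
  have gr: "ground (restrict (AG d) X) = X \<inter> ground (AG d)" by auto
  show ?thesis unfolding contains_copy_def gr by (simp add: * cong: conj_cong)
qed

lemma bij_betw_AG_Pow: "bij_betw (\<lambda>v. {i\<in>{1..d}. v i = 1}) (ground (AG d)) (Pow {1..d})"
proof (rule bij_betw_byWitness[where f' = "\<lambda>K i. if i = 0 \<or> i \<in> K then 1 else 0"])
  show "\<forall>v\<in>ground (AG d). (\<lambda>i. if i = 0 \<or> i \<in> {i\<in>{1..d}. v i = 1} then 1 else 0) = v"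
  proof
    fix v assume v: "v \<in> ground (AG d)"
    have "(if i = 0 \<or> i \<in> {i\<in>{1..d}. v i = 1} then 1 else 0) = v i" for i
      using v by (cases "v i") (auto simp: ground_AG not_le intro!: gr0I)
    then show "(\<lambda>i. if i = 0 \<or> i \<in> {i\<in>{1..d}. v i = 1} then 1 else 0) = v" by blast
  qed
qed (auto simp: ground_AG)

lemma finite_ground_AG: "finite (ground (AG d))"
  using bij_betw_finite[OF bij_betw_AG_Pow] by simp

lemma card_ground_AG: "card (ground (AG d)) = 2 ^ d"
  using bij_betw_same_card[OF bij_betw_AG_Pow] by (simp add: card_Pow)

lemma flip_in_AG: "v \<in> ground (AG d) \<Longrightarrow> 0 < i \<Longrightarrow> i \<le> d \<Longrightarrow> v(i := v i + 1) \<in> ground (AG d)"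
  by (auto simp: ground_AG)

lemma origin_in_AG: "(\<lambda>i. if i = 0 then 1 else 0) \<in> ground (AG d)"
  by (auto simp: ground_AG)

text \<open>Coordinate 0 is fixed to one on \<open>AG d\<close>, so a nonzero index in
  \<open>S\<close> is needed to make \<open>dot S\<close> nonconstant; flipping that coordinate
  changes the value.\<close>

lemma ex_AG_dot:
  assumes S: "S \<subseteq> {..d}" "s \<in> S" "s \<noteq> 0"
  shows "\<exists>v\<in>ground (AG d). dot S v = a"
proof -
  let ?v = "\<lambda>i. if i = 0 then 1 else (0::bit)"
  have fin: "finite S" using finite_subset[OF S(1)] by simp
  have "dot S (?v(s := ?v s + 1)) = dot S ?v + 1" using dot_flip[OF fin, of ?v s] S by simp
  then have "dot S ?v = a \<or> dot S (?v(s := ?v s + 1)) = a" by (cases "dot S ?v"; cases a) simp_all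
  moreover have "s \<le> d" using S by auto
  then have "?v(s := ?v s + 1) \<in> ground (AG d)" using flip_in_AG[OF origin_in_AG] S(3) by blast
  ultimately show ?thesis using origin_in_AG[of d] by blast
qed

text \<open>Used to refute containment of one support in another. \<open>T = {0}\<close> is excluded
  because that functional is constantly one on \<open>AG d\<close>. If \<open>S\<close> and
  \<open>T\<close> differ only in index 0, their values always differ, and
  \<open>dot T v = 0\<close> suffices.\<close>

lemma ex_AG_dot_1_0:
  assumes S: "S \<subseteq> {..d}" "S \<noteq> {}" and T: "T \<subseteq> {..d}" "T \<noteq> {}" "T \<noteq> {0}" and ne: "S \<noteq> T"
  shows "\<exists>v\<in>ground (AG d). dot S v = 1 \<and> dot T v = 0"
proof -
  have fin: "finite S" "finite T" using finite_subset[OF S(1)] finite_subset[OF T(1)] by simp_all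
  have "\<not> T \<subseteq> {0}" using T by (simp add: subset_singleton_iff)
  then obtain t where t: "t \<in> T" "t \<noteq> 0" by auto
  consider (a) t where "t \<in> T" "t \<noteq> 0" "t \<notin> S" | (b) s where "s \<in> S" "s \<noteq> 0" "s \<notin> T" | (c) "S - {0} = T - {0}"
    by blast
  then show ?thesis
  proof cases
    case a
    have "\<exists>v\<in>ground (AG d). dot S v = 1"
    proof (cases "S = {0}")
      case True
      then show ?thesis
        using origin_in_AG[of d] by (intro bexI[of _ "\<lambda>i. if i = 0 then 1 else 0"]) auto
    next
      case False
      then have "\<not> S \<subseteq> {0}" using S by (simp add: subset_singleton_iff)
      then obtain s where "s \<in> S" "s \<noteq> 0" by auto
      then show ?thesis using ex_AG_dot[OF S(1)] by blast
    qed
    then obtain v where v: "v \<in> ground (AG d)" "dot S v = 1" by blast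
    have "dot S (v(t := v t + 1)) = 1" "dot T (v(t := v t + 1)) = dot T v + 1"
      unfolding dot_flip[OF fin(1)] dot_flip[OF fin(2)] using a v by auto
    then show ?thesis using v flip_in_AG[OF v(1), of t] a T(1) by (cases "dot T v") auto
  next
    case b
    obtain v where v: "v \<in> ground (AG d)" "dot T v = 0" using ex_AG_dot[OF T(1) t] by blast
    have "dot T (v(s := v s + 1)) = 0" "dot S (v(s := v s + 1)) = dot S v + 1"
      unfolding dot_flip[OF fin(1)] dot_flip[OF fin(2)] using b v by auto
    then show ?thesis using v flip_in_AG[OF v(1), of s] b S(1) by (cases "dot S v") auto
  next
    case c
    obtain v where v: "v \<in> ground (AG d)" "dot T v = 0" using ex_AG_dot[OF T(1) t] by blast
    have "S = insert 0 T \<and> 0 \<notin> T \<or> T = insert 0 S \<and> 0 \<notin> S" using c ne by blast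
    then have "dot S v = 1" using v dot_insert[OF fin(2), of 0 v] dot_insert[OF fin(1), of 0 v]
      by (cases "dot S v") (auto simp: ground_AG)
    then show ?thesis using v by blast
  qed
qed

section \<open>Copies of affine geometries\<close>

lemma card_le_twice_card_kernel:
  assumes fin: "finite F" and cl: "\<And>u v. u \<in> F \<Longrightarrow> v \<in> F \<Longrightarrow> u + v \<in> F"
  shows "card F \<le> 2 * card {v\<in>F. dot S v = 0}"
proof (cases "\<exists>u\<in>F. dot S u = 1")
  case True
  then obtain u where u: "u \<in> F" "dot S u = 1" by blast
  have eq: "{v\<in>F. dot S v = 0} \<union> {v\<in>F. dot S v = 1} = F" by auto
  have "card F \<le> card {v\<in>F. dot S v = 0} + card {v\<in>F. dot S v = 1}"
    using card_Un_le[of "{v\<in>F. dot S v = 0}" "{v\<in>F. dot S v = 1}"] unfolding eq .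
  moreover have "card {v\<in>F. dot S v = 1} \<le> card {v\<in>F. dot S v = 0}"
    using u cl fin by (intro card_inj_on_le[of "\<lambda>v. u + v"]) (auto simp: inj_on_def)
  ultimately show ?thesis by linarith
next
  case False
  then have "{v\<in>F. dot S v = 0} = F" by auto
  then show ?thesis by simp
qed

text \<open>The common kernel \<open>W\<close> of the two functionals on the directions
  \<open>F\<close> has dimension at least \<open>d - 2\<close>, because each functional at most
  halves the size. The points \<open>v0 + w\<close> with \<open>w \<in> W\<close> satisfy both
  equations.\<close>

lemma contains_copy_if_equations:
  assumes v0: "v0 \<in> ground (AG d)" and d: "d \<ge> 2"
    and X: "\<And>v. v \<in> ground (AG d) \<Longrightarrow> dot S v = dot S v0 \<Longrightarrow> dot T v = dot T v0 \<Longrightarrow> v \<in> X"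
  shows "contains_copy (restrict (AG d) X) (AG (d - 2))"
proof -
  define F where "F = {v::bitvec. v 0 = 0 \<and> (\<forall>i>d. v i = 0)}"
  define W where "W = {v\<in>{v\<in>F. dot S v = 0}. dot T v = 0}"
  have F: "F = (\<lambda>v. v0 + v) ` ground (AG d)"
  proof (intro equalityI subsetI)
    fix v assume "v \<in> F"
    then have "v0 + v \<in> ground (AG d)" using v0 by (simp add: F_def ground_AG)
    moreover have "v = v0 + (v0 + v)" by simp
    ultimately show "v \<in> (\<lambda>v. v0 + v) ` ground (AG d)" by blast
  qed (use v0 in \<open>auto simp: F_def ground_AG\<close>)
  have finF: "finite F" unfolding F using finite_ground_AG by blast
  have "card F = 2 ^ d" unfolding F by (subst card_image) (auto simp: inj_on_def card_ground_AG)
  moreover have "card F \<le> 2 * card {v\<in>F. dot S v = 0}"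
    using finF by (intro card_le_twice_card_kernel) (auto simp: F_def)
  moreover have "card {v\<in>F. dot S v = 0} \<le> 2 * card W"
    unfolding W_def using finF by (intro card_le_twice_card_kernel) (simp, auto simp: F_def)
  moreover have "(2::nat) ^ d = 4 * 2 ^ (d - 2)"
    using d by (auto dest!: le_Suc_ex simp: power_add)
  ultimately have cardW: "2 ^ (d - 2) \<le> card W" by linarith
  have finW: "finite W" using finF unfolding W_def by simp
  have subW: "bitvec.subspace W"
    unfolding bitvec.subspace_def
  proof (intro conjI ballI allI)
    show "0 \<in> W" by (simp add: W_def F_def)
    show "u + v \<in> W" if "u \<in> W" "v \<in> W" for u v using that by (simp add: W_def F_def)
    show "bitvec_scale c v \<in> W" if "v \<in> W" for c v using that \<open>0 \<in> W\<close> by (cases c) simp_all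
  qed
  obtain B where B: "B \<subseteq> W" "bitvec.independent B" "W \<subseteq> bitvec.span B"
    using bitvec.maximal_independent_subset by blast
  have finB: "finite B" using B(1) finW finite_subset by blast
  have "card W \<le> card ((\<lambda>J. \<Sum>J) ` Pow B)"
    using B(3) span_subset_sums[OF finB] finB by (intro card_mono) auto
  also have "\<dots> \<le> card (Pow B)" using finB by (intro card_image_le) simp
  finally have "card W \<le> 2 ^ card B" using finB by (simp add: card_Pow)
  then have "(2::nat) ^ (d - 2) \<le> 2 ^ card B" using cardW by linarith
  then have "d - 2 \<le> card B" by simp
  \<comment> \<open>The equations may be dependent or trivial, so \<open>W\<close> can be too large;
    only \<open>d - 2\<close> independent directions are kept.\<close>
  then obtain B' where B': "B' \<subseteq> B" "card B' = d - 2" using obtain_subset_with_card_n by metis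
  have finB': "finite B'" using B'(1) finB finite_subset by blast
  then obtain b where b: "bij_betw b {1..d-2} B'" using ex_bij_betw_nat_finite_1 B'(2) by metis
  \<comment> \<open>An affine frame with base point \<open>v0\<close> at index 0. On vectors whose
    coordinate 0 is one, the linear map \<open>L\<close> adds directions to \<open>v0\<close>, so it
    sends \<open>AG (d - 2)\<close> into \<open>v0 + W\<close>.\<close>
  define c where "c i = (if i = 0 then v0 else b i)" for i :: nat
  have v0W: "v0 \<notin> W" using v0 by (auto simp: W_def F_def ground_AG)
  have split: "{..d-2} = insert 0 {1..d-2}" by auto
  have cb: "c i = b i" if "i \<in> {1..d-2}" for i using that by (simp add: c_def)
  have bW: "b i \<in> W" if "i \<in> {1..d-2}" for i
    using bij_betwE[OF b] that B'(1) B(1) by blast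
  have c_im: "c ` {1..d-2} = B'" using cb bij_betw_imp_surj_on[OF b] by (metis image_cong)
  have c_inj: "inj_on c {..d-2}"
    unfolding split inj_on_insert
  proof
    show "inj_on c {1..d-2}" using cb bij_betw_imp_inj_on[OF b] by (metis inj_on_cong)
    show "c 0 \<notin> c ` ({1..d-2} - {0})" using c_im v0W B'(1) B(1) by (auto simp: c_def)
  qed
  have "bitvec.span B' \<subseteq> W" using B'(1) B(1) by (intro bitvec.span_minimal[OF _ subW]) blast
  then have "bitvec.independent (insert v0 B')"
    using v0W bitvec.independent_mono[OF B(2) B'(1)] by (intro bitvec.independent_insertI) auto
  moreover have "c ` {..d-2} = insert v0 B'" unfolding split image_insert c_im by (simp add: c_def)
  ultimately have c_indep: "(\<Sum>i\<in>J. c i) \<noteq> 0" if "J \<subseteq> {..d-2}" "J \<noteq> {}" for J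
    using independent_image_iff[OF c_inj] that by simp
  define L where "L v = (\<Sum>i\<le>d-2. bitvec_scale (v i) (c i))" for v :: bitvec
  have L_add: "L (u + v) = L u + L v" for u v
    unfolding L_def by (simp add: bitvec.scale_left_distrib sum.distrib)
  have L_0: "L 0 = 0" unfolding L_def by (simp add: zero_fun_def[symmetric])
  have L_sum: "L (\<Sum>J) = (\<Sum>x\<in>J. L x)" for J
    by (induction J rule: infinite_finite_induct) (simp_all only: sum.infinite sum.empty sum.insert L_0 L_add not_False_eq_True)
  have L_kernel: "v = 0" if v: "L v = 0" "\<forall>i>d-2. v i = 0" for v
  proof -
    have "L v = (\<Sum>i\<in>{i\<in>{..d-2}. v i = 1}. c i)"
      unfolding L_def by (intro sum.mono_neutral_cong_right) auto
    moreover have "{i\<in>{..d-2}. v i = 1} \<subseteq> {..d-2}" by blast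
    ultimately have "{i\<in>{..d-2}. v i = 1} = {}" using v(1) c_indep by metis
    then have "v i = 0" for i using v(2) by (cases "i \<le> d - 2") auto
    then show "v = 0" by (simp add: fun_eq_iff)
  qed
  let ?A = "ground (AG (d - 2))"
  have L_in: "L v \<in> ground (AG d) \<and> dot S (L v) = dot S v0 \<and> dot T (L v) = dot T v0" if v: "v \<in> ?A" for v
  proof -
    have "L v = bitvec_scale (v 0) (c 0) + (\<Sum>i\<in>{1..d-2}. bitvec_scale (v i) (c i))"
      unfolding L_def split by (subst sum.insert) auto
    also have "bitvec_scale (v 0) (c 0) = v0" using v by (simp add: ground_AG c_def)
    finally have Lv: "L v = v0 + (\<Sum>i\<in>{1..d-2}. bitvec_scale (v i) (c i))" .
    have "(\<Sum>i\<in>{1..d-2}. bitvec_scale (v i) (c i)) \<in> W"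
      using bW cb by (intro bitvec.subspace_sum[OF subW] bitvec.subspace_scale[OF subW]) auto
    then obtain w where w: "w \<in> W" "L v = v0 + w" using Lv by metis
    show ?thesis unfolding w(2) using w(1) v0 by (simp add: W_def F_def ground_AG)
  qed
  have L_inj: "inj_on L ?A"
  proof (rule inj_onI)
    fix u v assume uv: "u \<in> ?A" "v \<in> ?A" "L u = L v"
    then have "L (u + v) = 0" by (simp only: L_add bitvec_add_self)
    moreover have "\<forall>i>d-2. (u + v) i = 0" using uv by (simp add: ground_AG)
    ultimately show "u = v" using L_kernel[of "u + v"] by (simp only: bitvec_add_eq_0_iff)
  qed
  have ind: "bitvec.independent (L ` K) \<longleftrightarrow> bitvec.independent K" if K: "K \<subseteq> ?A" for K
  proof -
    have finK: "finite K" using K finite_ground_AG finite_subset by blast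
    have "(\<Sum>x\<in>J. L x) \<noteq> 0 \<longleftrightarrow> \<Sum>J \<noteq> 0" if J: "J \<subseteq> K" for J
    proof -
      have "\<forall>i>d-2. (\<Sum>J) i = 0"
        unfolding sum_fun_apply[of "\<lambda>x. x"] using J K by (auto simp: ground_AG intro!: sum.neutral)
      then show ?thesis unfolding L_sum[symmetric] using L_kernel[of "\<Sum>J"] L_0 by metis
    qed
    then show ?thesis
      unfolding independent_image_iff[OF inj_on_subset[OF L_inj K] finK] independent_iff_sum_nonzero[OF finK]
      by auto
  qed
  let ?f = "inv_into ?A L"
  have f: "bij_betw ?f (L ` ?A) ?A" using L_inj by (intro bij_betw_inv_into) (simp add: bij_betw_def)
  show ?thesis
    unfolding contains_copy_AG_iff
  proof (intro exI[of _ "L ` ?A"] exI[of _ ?f] conjI allI impI)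
    show "L ` ?A \<subseteq> X \<inter> ground (AG d)" using L_in X by blast
    fix I assume I: "I \<subseteq> L ` ?A"
    then have "L ` (?f ` I) = I" by (rule image_inv_into_cancel[OF refl])
    moreover have "?f ` I \<subseteq> ?A" using I f unfolding bij_betw_def by blast
    ultimately show "bitvec.independent I \<longleftrightarrow> bitvec.independent (?f ` I)" using ind by metis
  qed (rule f)
qed

text \<open>If no such \<open>J\<close> exists, every single element of \<open>U\<close> is cut out
  by a member of \<open>W\<close>. Sums of these members cut out all subsets of \<open>U\<close>, so
  \<open>W\<close> has at least \<open>2 ^ card U\<close> members.\<close>

lemma orthogonal_subset_if_card_less:
  assumes fin: "finite U" "finite W" and cl: "\<And>z w. z \<in> W \<Longrightarrow> w \<in> W \<Longrightarrow> sym_diff z w \<in> W"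
    and ne: "{} \<in> W" and less: "card W < 2 ^ card U"
  shows "\<exists>J\<subseteq>U. J \<noteq> {} \<and> (\<forall>w\<in>W. even (card (J \<inter> w)))"
proof (rule ccontr)
  assume no: "\<not> ?thesis"
  have iso: "\<exists>z\<in>W. z \<inter> U = {f}" if "f \<in> U" for f
    using isolating_member_or_orthogonal_subset[OF fin(1) that cl] no by blast
  have "\<exists>z\<in>W. z \<inter> U = K" if K: "K \<subseteq> U" for K
  proof -
    have "finite K" using K fin finite_subset by blast
    then show ?thesis using K
    proof (induction K rule: finite_induct)
      case empty
      show ?case using ne by blast
    next
      case (insert f K)
      then obtain z where z: "z \<in> W" "z \<inter> U = K" by blast
      obtain w where w: "w \<in> W" "w \<inter> U = {f}" using iso insert by blast
      have "sym_diff z w \<inter> U = sym_diff (z \<inter> U) (w \<inter> U)" by blast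
      also have "\<dots> = insert f K" unfolding z(2) w(2) using insert.hyps by blast
      finally show ?case using cl[OF z(1) w(1)] by blast
    qed
  qed
  then have "Pow U \<subseteq> (\<lambda>z. z \<inter> U) ` W" by blast
  then have "card (Pow U) \<le> card W" using surj_card_le[OF fin(2)] by blast
  then show False using less fin by (simp add: card_Pow)
qed

text \<open>The image geometry contains \<open>f a + f b + f c\<close>; its preimage
  \<open>x\<close> makes \<open>{a,b,c,x}\<close> dependent. Four distinct affine points over GF(2)
  are dependent only if they sum to zero, so \<open>x\<close> is \<open>a + b + c\<close>.\<close>

lemma AG_copy_closed:
  assumes Y: "Y \<subseteq> ground (AG d)" and f: "bij_betw f Y (ground (AG d'))"
    and ind: "\<And>I. I \<subseteq> Y \<Longrightarrow> bitvec.independent I \<longleftrightarrow> bitvec.independent (f ` I)"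
    and abc: "a \<in> Y" "b \<in> Y" "c \<in> Y"
  shows "a + b + c \<in> Y"
proof (cases "a = b \<or> a = c \<or> b = c")
  case True
  moreover have "a + b + a = b" using bitvec_add_add_self(1)[of b a] by (simp only: add.commute[of a b])
  ultimately show ?thesis using abc by auto
next
  case False
  have inj: "inj_on f Y" using bij_betw_imp_inj_on[OF f] .
  have fA: "f x \<in> ground (AG d')" if "x \<in> Y" for x using bij_betwE[OF f] that by blast
  have "f a + f b + f c \<in> ground (AG d')"
    using fA[OF abc(1)] fA[OF abc(2)] fA[OF abc(3)] by (simp add: ground_AG)
  then obtain x where x: "x \<in> Y" "f x = f a + f b + f c" using bij_betw_imp_surj_on[OF f] by (metis imageE)
  have neq: "f a \<noteq> f b" "f a \<noteq> f c" "f b \<noteq> f c" using inj abc False by (auto dest: inj_onD)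
  have cancel: "f a + f b + f c \<noteq> f a" "f a + f b + f c \<noteq> f b" "f a + f b + f c \<noteq> f c"
  proof -
    have "f b + f c = 0" if "f a + f b + f c = f a" using that by (simp add: add.assoc)
    moreover have "f a + f c = 0" if "f a + f b + f c = f b" using that by (simp add: ac_simps)
    moreover have "f a + f b = 0" if "f a + f b + f c = f c" using that by simp
    ultimately show "f a + f b + f c \<noteq> f a" "f a + f b + f c \<noteq> f b" "f a + f b + f c \<noteq> f c"
      using neq by (auto simp: bitvec_add_eq_0_iff)
  qed
  then have xne: "x \<noteq> a" "x \<noteq> b" "x \<noteq> c" using x(2) by auto
  let ?I = "{a,b,c,x}"
  have IY: "?I \<subseteq> Y" using abc x by blast
  have "\<Sum>(f ` ?I) = (\<Sum>y\<in>?I. f y)"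
    using inj_on_subset[OF inj IY] by (simp only: sum.reindex o_def)
  also have "\<dots> = f a + f b + f c + f x" using False xne by (simp add: add.assoc)
  also have "\<dots> = 0" unfolding x(2) by (rule bitvec_add_self)
  finally have sum0: "\<Sum>(f ` ?I) = 0" .
  have finfI: "finite (f ` ?I)" by simp
  have "\<not> bitvec.independent (f ` ?I)" unfolding independent_iff_sum_nonzero[OF finfI] using sum0 by blast
  then have "\<not> bitvec.independent ?I" using ind[OF IY] by blast
  moreover have finI: "finite ?I" by simp
  ultimately obtain J where J: "J \<subseteq> ?I" "J \<noteq> {}" "\<Sum>J = 0"
    unfolding independent_iff_sum_nonzero[OF finI] by blast
  have finJ: "finite J" using J(1) finI finite_subset by blast
  \<comment> \<open>All points have coordinate 0 equal to one, so a set of points summing to zero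
    has even size; size two would mean two equal points.\<close>
  have "(\<Sum>v\<in>J. v 0) = 0" using J(3) sum_fun_apply[of "\<lambda>v. v" J 0] by simp
  then have "even (card {v\<in>J. v 0 = 1})" using sum_bit_eq_0_iff[OF finJ, of "\<lambda>v. v 0"] by simp
  moreover have "{v\<in>J. v 0 = 1} = J" using J(1) IY Y by (auto simp: ground_AG)
  ultimately have evJ: "even (card J)" by simp
  have cardI: "card ?I = 4" using False xne by auto
  have "card J \<le> 4" using card_mono[OF finI J(1)] cardI by simp
  moreover have "card J \<noteq> 0" using J(2) finJ by simp
  ultimately have "card J = 2 \<or> card J = 4" using evJ by presburger
  moreover have "card J \<noteq> 2"
  proof
    assume "card J = 2"
    then obtain u v where "J = {u,v}" "u \<noteq> v" by (meson card_2_iff)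
    then show False using J(3) by (simp add: bitvec_add_eq_0_iff)
  qed
  ultimately have "J = ?I" using card_subset_eq[OF finI J(1)] cardI by simp
  then have "a + b + c + x = 0" using J(3) False xne by (simp add: add.assoc)
  then show ?thesis using x(1) by (simp add: bitvec_add_eq_0_iff)
qed

text \<open>Translated by \<open>a0\<close>, the closed set \<open>Y\<close> is a vector space of
  \<open>2 ^ (d - 2)\<close> vectors, encoded as coordinate sets in \<open>W\<close>. Two
  independent functionals vanish on it, and their common solution set \<open>R\<close> is no larger
  than \<open>Y\<close>.\<close>

lemma equations_if_AG_copy:
  assumes d: "d \<ge> 2" and Y: "Y \<subseteq> ground (AG d)" and f: "bij_betw f Y (ground (AG (d - 2)))"
    and ind: "\<And>I. I \<subseteq> Y \<Longrightarrow> bitvec.independent I \<longleftrightarrow> bitvec.independent (f ` I)"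
  obtains S T a b where "S \<subseteq> {1..d}" "T \<subseteq> {1..d}" "S \<noteq> {}" "T \<noteq> {}" "S \<noteq> T"
    "\<And>v. v \<in> ground (AG d) \<Longrightarrow> dot S v = a \<Longrightarrow> dot T v = b \<Longrightarrow> v \<in> Y"
proof -
  have closed: "u + v + w \<in> Y" if "u \<in> Y" "v \<in> Y" "w \<in> Y" for u v w
    by (rule AG_copy_closed[OF Y f _ that]) (rule ind)
  have finY: "finite Y" using Y finite_ground_AG finite_subset by blast
  have cardY: "card Y = 2 ^ (d - 2)" using bij_betw_same_card[OF f] card_ground_AG by simp
  then have "Y \<noteq> {}" by auto
  then obtain a0 where a0: "a0 \<in> Y" by blast
  define W where "W = (\<lambda>v. {i. (a0 + v) i = 1}) ` Y"
  have inj: "inj_on (\<lambda>v. {i. (a0 + v) i = 1}) Y"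
  proof (rule inj_onI)
    fix u v assume eq: "{i. (a0 + u) i = 1} = {i. (a0 + v) i = 1}"
    have "u i = v i" for i
    proof -
      have "(a0 i + u i = 1) \<longleftrightarrow> (a0 i + v i = 1)" using eq by auto
      then show ?thesis by (cases "a0 i"; cases "u i"; cases "v i") simp_all
    qed
    then show "u = v" by blast
  qed
  have finW: "finite W" and cardW: "card W = 2 ^ (d - 2)"
    unfolding W_def using finY cardY card_image[OF inj] by auto
  have W0: "{} \<in> W" unfolding W_def by (intro image_eqI[of _ _ a0] a0) simp
  have Wcl: "sym_diff z w \<in> W" if zw: "z \<in> W" "w \<in> W" for z w
  proof -
    obtain u v where uv: "u \<in> Y" "v \<in> Y" "z = {i. (a0 + u) i = 1}" "w = {i. (a0 + v) i = 1}"
      using zw unfolding W_def by blast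
    have *: "(x + y = 1) \<noteq> (x + y' = 1) \<longleftrightarrow> x + (x + y + y') = 1" for x y y' :: bit
      by (cases x; cases y; cases y') simp_all
    have "i \<in> sym_diff z w \<longleftrightarrow> i \<in> {i. (a0 + (a0 + u + v)) i = 1}" for i
      using *[of "a0 i" "u i" "v i"] unfolding uv plus_fun_apply by blast
    then have "sym_diff z w = {i. (a0 + (a0 + u + v)) i = 1}" by blast
    then show ?thesis unfolding W_def using closed[OF a0 uv(1,2)] by blast
  qed
  have orth: "dot J v = dot J a0" if J: "J \<subseteq> {1..d}" "\<forall>w\<in>W. even (card (J \<inter> w))" and v: "v \<in> Y" for J v
  proof -
    have finJ: "finite J" using J(1) finite_subset by blast
    have "even (card (J \<inter> {i. (a0 + v) i = 1}))" using J(2) v unfolding W_def by blast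
    moreover have "J \<inter> {i. (a0 + v) i = 1} = {i\<in>J. (a0 + v) i = 1}" by blast
    ultimately have "dot J (a0 + v) = 0" unfolding dot_def using sum_bit_eq_0_iff[OF finJ] by metis
    then show ?thesis by simp
  qed
  have p: "(2::nat) ^ (d - 2) < 2 ^ (d - 1)" "(2::nat) ^ (d - 2) < 2 ^ d"
    using d by (auto intro!: power_strict_increasing)
  obtain S where S: "S \<subseteq> {1..d}" "S \<noteq> {}" "\<forall>w\<in>W. even (card (S \<inter> w))"
    using orthogonal_subset_if_card_less[of "{1..d}" W, OF _ finW Wcl W0] p(2) cardW by auto
  then obtain j where j: "j \<in> S" by blast
  have jd: "j \<in> {1..d}" using j S by blast
  \<comment> \<open>Searching without the index \<open>j\<close> of \<open>S\<close> makes
    \<open>T\<close> independent of \<open>S\<close>; the remaining \<open>d - 1\<close> indices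
    still outnumber the dimension \<open>d - 2\<close> of \<open>W\<close>.\<close>
  obtain T where T: "T \<subseteq> {1..d} - {j}" "T \<noteq> {}" "\<forall>w\<in>W. even (card (T \<inter> w))"
    using orthogonal_subset_if_card_less[of "{1..d} - {j}" W, OF _ finW Wcl W0] p(1) cardW jd by auto
  then obtain k where k: "k \<in> T" by blast
  have kj: "k \<noteq> j" "k \<in> {1..d}" "j \<notin> T" using k T by auto
  have finST: "finite S" "finite T" using finite_subset[OF S(1)] finite_subset[OF T(1)] by simp_all
  define R where "R = {v\<in>ground (AG d). dot S v = dot S a0 \<and> dot T v = dot T a0}"
  have YR: "Y \<subseteq> R" unfolding R_def using Y orth[OF S(1,3)] orth[OF _ T(3)] T(1) by blast
  have finR: "finite R" unfolding R_def using finite_ground_AG by simp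
  have dot_eq: "u l = v l" if "finite J" "l \<in> J" "dot J u = dot J v" "\<And>i. i \<in> J - {l} \<Longrightarrow> u i = v i" for J l u v
  proof -
    have "dot J u = u l + dot (J - {l}) u" "dot J v = v l + dot (J - {l}) v"
      unfolding dot_def using that(1,2) by (simp_all add: sum.remove)
    then show ?thesis using that(3) dot_cong[of "J - {l}" u v] that(4) by simp
  qed
  \<comment> \<open>The equation for \<open>T\<close>, which lacks \<open>j\<close>, recovers
    coordinate \<open>k\<close>; then the equation for \<open>S\<close> recovers coordinate
    \<open>j\<close>. So the other coordinates determine a point of \<open>R\<close>.\<close>
  have "inj_on (\<lambda>v. {i\<in>{1..d} - {j,k}. v i = 1}) R"
  proof (rule inj_onI)
    fix u v assume uv: "u \<in> R" "v \<in> R" "{i\<in>{1..d} - {j,k}. u i = 1} = {i\<in>{1..d} - {j,k}. v i = 1}"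
    have eq1: "u i = v i" if "i \<notin> {j,k}" for i
    proof -
      consider "i = 0" | "i > d" | "i \<in> {1..d} - {j,k}" using \<open>i \<notin> {j,k}\<close> by fastforce
      then show ?thesis
      proof cases
        case 3
        then have "u i = 1 \<longleftrightarrow> v i = 1" using uv(3) by blast
        then show ?thesis by (cases "u i"; cases "v i") auto
      qed (use uv in \<open>auto simp: R_def ground_AG\<close>)
    qed
    have "u k = v k"
    proof (rule dot_eq[OF finST(2) k])
      show "dot T u = dot T v" using uv(1,2) by (simp add: R_def)
      show "u i = v i" if "i \<in> T - {k}" for i using that T(1) by (intro eq1) blast
    qed
    then have eq2: "u i = v i" if "i \<noteq> j" for i using eq1[of i] that by (cases "i = k") auto
    have "u j = v j"
    proof (rule dot_eq[OF finST(1) j])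
      show "dot S u = dot S v" using uv(1,2) by (simp add: R_def)
      show "u i = v i" if "i \<in> S - {j}" for i using that by (intro eq2) blast
    qed
    then show "u = v" using eq2 by (intro ext) metis
  qed
  then have "card R \<le> card (Pow ({1..d} - {j,k}))" by (rule card_inj_on_le) auto
  also have "\<dots> = 2 ^ (d - 2)" using jd kj by (simp add: card_Pow card_Diff_subset)
  finally have "Y = R" using card_seteq[OF finR YR] cardY by simp
  then have "v \<in> Y" if "v \<in> ground (AG d)" "dot S v = dot S a0" "dot T v = dot T a0" for v
    using that unfolding R_def by blast
  moreover have "S \<noteq> T" "T \<subseteq> {1..d}" using j kj T by auto
  ultimately show ?thesis using that S T by blast
qed

section \<open>Affine representations\<close>

text \<open>\<open>Z\<close> is taken as the row space of the matrix with columns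
  \<open>\<Phi> x\<close>. The absence of a copy in \<open>X\<close> prevents proper containment
  among the nonempty members other than \<open>D\<close>, which makes these members exactly the
  circuits.\<close>

lemma almost_cycle_space_if_affine:
  assumes M: "is_matroid M" and d: "d \<ge> 2" and e: "e \<in> hyperplane_at_infinity d"
    and eX: "e \<notin> X" and no_copy: "\<not> contains_copy (restrict (AG d) X) (AG (d - 2))"
    and \<Phi>: "bij_betw \<Phi> (ground M) (ground (AG_plus d e) - X)"
    and ind: "\<And>I. I \<subseteq> ground M \<Longrightarrow> I \<in> indep_sets (dual M) \<longleftrightarrow> bitvec.independent (\<Phi> ` I)"
  shows "\<exists>e Z. almost_cycle_space M e Z"
proof -
  let ?E = "ground M"
  let ?supp = "support ?E \<Phi>"
  let ?Z = "?supp ` Pow {..<Suc d}"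
  have inj: "inj_on \<Phi> ?E" using bij_betw_imp_inj_on[OF \<Phi>] .
  have im: "\<Phi> ` ?E = insert e (ground (AG d)) - X" using bij_betw_imp_surj_on[OF \<Phi>] ground_AG_plus[OF e] by simp
  have e0: "e 0 = 0" "e \<noteq> 0" "\<And>i. i > d \<Longrightarrow> e i = 0" using e by (auto simp: hyperplane_at_infinity_def ground_PG)
  obtain x0 where x0: "x0 \<in> ?E" "\<Phi> x0 = e" using im eX by (metis Diff_iff imageE insertI1)
  have \<Phi>0: "\<Phi> x 0 = 1" "\<Phi> x \<in> ground (AG d)" if "x \<in> ?E" "x \<noteq> x0" for x
  proof -
    have "\<Phi> x \<noteq> e" using inj_onD[OF inj, of x x0] x0 that by auto
    then show "\<Phi> x \<in> ground (AG d)" using im that(1) by blast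
    then show "\<Phi> x 0 = 1" by (simp add: ground_AG)
  qed
  have \<Phi>d: "\<Phi> x i = 0" if "x \<in> ?E" "i \<ge> Suc d" for x i
    using \<Phi>0(2)[OF that(1)] x0 e0(3) that(2) by (cases "x = x0") (auto simp: ground_AG)
  have cl: "\<And>z w. z \<in> ?Z \<Longrightarrow> w \<in> ?Z \<Longrightarrow> sym_diff z w \<in> ?Z" by (rule supports_closed)
  have ZE: "z \<subseteq> ?E" if "z \<in> ?Z" for z using that by (auto simp: support_def)
  have par: "I \<in> indep_sets (dual M) \<longleftrightarrow> parity_indep ?Z I" if "I \<subseteq> ?E" for I
    unfolding ind[OF that] using that inj_on_subset[OF inj that] finite_subset[OF that matroid_finite[OF M]] \<Phi>d
    by (intro independent_image_iff_parity_indep) auto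
  have dep: "A \<notin> indep_sets M \<longleftrightarrow> (\<exists>z\<in>?Z. z \<noteq> {} \<and> z \<subseteq> A)" if "A \<subseteq> ?E" for A
    by (rule dependent_iff_contains_member[OF M _ _ _ that]) (rule cl ZE par; assumption)+
  \<comment> \<open>Otherwise all points of \<open>AG d\<close> sharing the two values with
    \<open>v\<close> are deleted, and they contain a forbidden copy. So whatever two functionals do
    on \<open>AG d\<close> is already visible on \<open>M\<close> without \<open>x0\<close>.\<close>
  have hit: "\<exists>x\<in>?E - {x0}. dot S (\<Phi> x) = dot S v \<and> dot T (\<Phi> x) = dot T v" if "v \<in> ground (AG d)" for S T v
  proof (rule ccontr)
    assume no: "\<not> ?thesis"
    have "u \<in> X" if u: "u \<in> ground (AG d)" "dot S u = dot S v" "dot T u = dot T v" for u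
    proof (rule ccontr)
      assume "u \<notin> X"
      then obtain x where x: "x \<in> ?E" "\<Phi> x = u" using im u(1) by (metis Diff_iff imageE insertI2)
      have "x \<noteq> x0" using x x0 u(1) e0(1) by (auto simp: ground_AG)
      then show False using no x u by blast
    qed
    then show False using contains_copy_if_equations[OF that d] no_copy by blast
  qed
  have supp0: "?supp {0} = ?E - {x0}"
    using \<Phi>0(1) x0 e0(1) by (auto simp: support_def)
  have supp_empty: "S = {}" if S: "S \<subseteq> {..<Suc d}" "?supp S = {}" for S
  proof (rule ccontr)
    assume ne: "S \<noteq> {}"
    have "\<exists>v\<in>ground (AG d). dot S v = 1"
    proof (cases "S = {0}")
      case True
      then show ?thesis
        using origin_in_AG[of d] by (intro bexI[of _ "\<lambda>i. if i = 0 then 1 else 0"]) auto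
    next
      case False
      then have "\<not> S \<subseteq> {0}" using ne by (simp add: subset_singleton_iff)
      then obtain s where "s \<in> S" "s \<noteq> 0" by auto
      then show ?thesis using ex_AG_dot[of S d s 1] S(1) by (auto simp: lessThan_Suc_atMost)
    qed
    then obtain x where "x \<in> ?E" "dot S (\<Phi> x) = 1" using hit[of _ S S] by (metis Diff_iff)
    then show False using S(2) by (auto simp: support_def)
  qed
  have supp_inj: "S = T" if ST: "S \<subseteq> {..<Suc d}" "T \<subseteq> {..<Suc d}" "?supp S = ?supp T" for S T
  proof -
    have "finite S" "finite T" using finite_subset[OF ST(1)] finite_subset[OF ST(2)] by simp_all
    then have "?supp (sym_diff S T) = {}" using ST(3) by (simp add: support_sym_diff)
    moreover have "sym_diff S T \<subseteq> {..<Suc d}" using ST by blast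
    ultimately have "sym_diff S T = {}" using supp_empty by blast
    then show ?thesis by blast
  qed
  have minimal: "w = z" if zw: "z \<in> ?Z" "w \<in> ?Z" "z \<noteq> ?E - {x0}" "w \<noteq> {}" "w \<subseteq> z" for z w
  proof (rule ccontr)
    assume ne: "w \<noteq> z"
    obtain T where T: "T \<subseteq> {..<Suc d}" "z = ?supp T" using zw(1) by blast
    obtain S where S: "S \<subseteq> {..<Suc d}" "w = ?supp S" using zw(2) by blast
    have "S \<noteq> {}" "T \<noteq> {}" "T \<noteq> {0}" "S \<noteq> T" using S T zw ne supp0 by auto
    then obtain v where v: "v \<in> ground (AG d)" "dot S v = 1" "dot T v = 0"
      using ex_AG_dot_1_0[of S d T] S(1) T(1) by (auto simp: lessThan_Suc_atMost)
    obtain x where "x \<in> ?E" "dot S (\<Phi> x) = 1" "dot T (\<Phi> x) = 0" using hit[OF v(1), of S T] v by auto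
    then have "x \<in> w" "x \<notin> z" unfolding S(2) T(2) by (auto simp: support_def)
    then show False using zw(5) by blast
  qed
  have D: "?E - {x0} \<in> ?Z" using supp0[symmetric] by (intro image_eqI[of _ _ "{0}"]) auto
  have small: "\<exists>z\<in>?Z. z \<noteq> {} \<and> z \<subset> ?E - {x0}"
  proof -
    \<comment> \<open>A nonzero functional other than \<open>dot {0}\<close> that vanishes at
      \<open>e\<close>. If neither coordinate 1 nor coordinate 2 of \<open>e\<close> is zero, their
      sum is; this is where \<open>d \<ge> 2\<close> enters.\<close>
    define S :: "nat set" where "S = (if e 1 = 0 then {1} else if e 2 = 0 then {2} else {1,2})"
    have "e 1 + e 2 = 0" if "e 1 = 1" "e 2 = 1" using that by simp
    then have Se: "dot S e = 0" by (auto simp: S_def dot_insert)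
    have Sd: "S \<subseteq> {..<Suc d}" "S \<noteq> {}" "S \<noteq> {0}" using d by (auto simp: S_def)
    have "?supp S \<noteq> {}" using supp_empty Sd by blast
    moreover have "?supp S \<noteq> ?supp {0}" using supp_inj[of S "{0}"] Sd by auto
    moreover have "?supp S \<subseteq> ?E - {x0}" using Se x0 by (auto simp: support_def)
    ultimately show ?thesis using Sd(1) supp0 by (intro bexI[of _ "?supp S"]) auto
  qed
  have circ: "circuit M C \<longleftrightarrow> C \<in> ?Z \<and> C \<noteq> {} \<and> C \<noteq> ?E - {x0}" for C
  proof
    assume C: "circuit M C"
    note CE = circuit_ground[OF C]
    obtain z where z: "z \<in> ?Z" "z \<noteq> {}" "z \<subseteq> C" using dep[OF CE] circuit_dependent[OF C] by blast
    have "z \<notin> indep_sets M" using dep[OF ZE[OF z(1)]] z by blast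
    then have "z = C" using circuit_psubset_indep[OF C, of z] z(3) by blast
    moreover have "C \<noteq> ?E - {x0}"
    proof
      assume CD: "C = ?E - {x0}"
      obtain y where y: "y \<in> ?Z" "y \<noteq> {}" "y \<subset> C" using small CD by blast
      then have "y \<notin> indep_sets M" using dep[OF ZE[OF y(1)]] by blast
      then show False using circuit_psubset_indep[OF C y(3)] by blast
    qed
    ultimately show "C \<in> ?Z \<and> C \<noteq> {} \<and> C \<noteq> ?E - {x0}" using z by blast
  next
    assume C: "C \<in> ?Z \<and> C \<noteq> {} \<and> C \<noteq> ?E - {x0}"
    then have CE: "C \<subseteq> ?E" using ZE by blast
    have "B \<in> indep_sets M" if B: "B \<subset> C" for B
    proof (rule ccontr)
      assume "B \<notin> indep_sets M"
      then obtain w where w: "w \<in> ?Z" "w \<noteq> {}" "w \<subseteq> B" using dep[of B] B CE by blast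
      then show False using minimal[of C w] C B by blast
    qed
    moreover have "C \<notin> indep_sets M" using dep[OF CE] C by blast
    ultimately show "circuit M C" unfolding circuit_def using CE by blast
  qed
  have coord: "?supp {i} \<in> ?Z" if "i \<le> d" for i
    using that by (intro imageI) auto
  have ez: "\<exists>z\<in>?Z. x0 \<in> z"
  proof -
    obtain i where i: "e i \<noteq> 0" using e0(2) by (auto simp: fun_eq_iff)
    then have "i \<le> d" using e0(3) not_le by blast
    have "x0 \<in> ?supp {i}" using x0 i by (simp add: support_def)
    then show ?thesis using coord[OF \<open>i \<le> d\<close>] by (rule bexI)
  qed
  have sep: "\<exists>z\<in>?Z. (x \<in> z) \<noteq> (y \<in> z)" if xy: "x \<in> ?E" "y \<in> ?E" "x \<noteq> y" for x y
  proof -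
    have "\<Phi> x \<noteq> \<Phi> y" using inj_onD[OF inj] xy by blast
    then obtain i where i: "\<Phi> x i \<noteq> \<Phi> y i" by (auto simp: fun_eq_iff)
    then have "i \<le> d" using \<Phi>d xy by (metis not_less_eq_eq)
    have "(x \<in> ?supp {i}) \<noteq> (y \<in> ?supp {i})"
      using i xy by (cases "\<Phi> x i"; cases "\<Phi> y i") (auto simp: support_def)
    then show ?thesis using coord[OF \<open>i \<le> d\<close>] by (rule bexI)
  qed
  have "{} \<in> ?Z" by (intro image_eqI[of _ _ "{}"]) auto
  then have "almost_cycle_space M x0 ?Z"
    unfolding almost_cycle_space_def using x0(1) D cl circ ez small sep by (intro conjI) simp_all
  then show ?thesis by blast
qed

section \<open>From the cycle space to an affine representation\<close>

locale almost_cycle_space_matroid =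
  fixes M :: "'a matroid" and e Z
  assumes M: "is_matroid M" and Z: "almost_cycle_space M e Z"
begin

abbreviation "E \<equiv> ground M"
abbreviation "D \<equiv> ground M - {e}"

lemma
  shows eE: "e \<in> E" and Z_empty: "{} \<in> Z" and Z_D: "D \<in> Z"
    and Z_closed: "\<And>z w. z \<in> Z \<Longrightarrow> w \<in> Z \<Longrightarrow> sym_diff z w \<in> Z"
    and circuit_iff: "\<And>C. circuit M C \<longleftrightarrow> C \<in> Z \<and> C \<noteq> {} \<and> C \<noteq> D"
    and Z_e: "\<exists>z\<in>Z. e \<in> z" and Z_small: "\<exists>z\<in>Z. z \<noteq> {} \<and> z \<subset> D"
    and Z_separate: "\<And>x y. x \<in> E \<Longrightarrow> y \<in> E \<Longrightarrow> x \<noteq> y \<Longrightarrow> \<exists>z\<in>Z. (x \<in> z) \<noteq> (y \<in> z)"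
  using Z unfolding almost_cycle_space_def by auto

lemma Z_subset: "z \<in> Z \<Longrightarrow> z \<subseteq> E"
  using circuit_iff[of z] circuit_ground[of M z] by (cases "z = {} \<or> z = D") auto

lemma finite_Z: "finite Z"
  using Z_subset matroid_finite[OF M] by (intro finite_subset[of Z "Pow E"]) auto

lemma dependent_iff:
  assumes A: "A \<subseteq> E"
  shows "A \<notin> indep_sets M \<longleftrightarrow> (\<exists>z\<in>Z. z \<noteq> {} \<and> z \<subseteq> A)"
proof
  assume "A \<notin> indep_sets M"
  then obtain C where "circuit M C" "C \<subseteq> A" using dependent_contains_circuit[OF M A] by blast
  then show "\<exists>z\<in>Z. z \<noteq> {} \<and> z \<subseteq> A" using circuit_iff by blast
next
  assume "\<exists>z\<in>Z. z \<noteq> {} \<and> z \<subseteq> A"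
  then obtain z where z: "z \<in> Z" "z \<noteq> {}" "z \<subseteq> A" by blast
  have "\<exists>C. circuit M C \<and> C \<subseteq> A"
  proof (cases "z = D")
    case True
    obtain y where y: "y \<in> Z" "y \<noteq> {}" "y \<subset> D" using Z_small by blast
    then have "circuit M y" unfolding circuit_iff by auto
    then show ?thesis using y True z by blast
  next
    case False
    then have "circuit M z" using z circuit_iff by blast
    then show ?thesis using z by blast
  qed
  then show "A \<notin> indep_sets M" using indep_iff_no_circuit[OF M A] by blast
qed

text \<open>No circuit contains another one, so two of them never cut out an affine subspace of
  codimension two that avoids \<open>D\<close>.\<close>

lemma circuits_meet_in_D:
  assumes z: "z \<in> Z" "z \<noteq> {}" "z \<noteq> D" and w: "w \<in> Z" "w \<noteq> {}" "w \<noteq> D"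
    and ne: "z \<noteq> w" "sym_diff z w \<noteq> D"
  shows "z \<inter> w \<inter> D \<noteq> {}"
proof
  assume empty: "z \<inter> w \<inter> D = {}"
  have cz: "circuit M z" and cw: "circuit M w" using z w circuit_iff by blast+
  have zE: "z \<subseteq> E" "w \<subseteq> E" using z w Z_subset by auto
  have s: "sym_diff z w \<in> Z" "sym_diff z w \<noteq> {}" using Z_closed[OF z(1) w(1)] ne(1) by blast+
  then have cs: "circuit M (sym_diff z w)" using ne(2) circuit_iff by blast
  show False
  proof (cases "e \<in> z \<and> e \<in> w")
    case False
    then have "z \<inter> w = {}" using empty zE by blast
    then have "z \<subseteq> sym_diff z w" by blast
    then have "z = sym_diff z w" using circuit_subset_eq[OF cz cs] by blast
    then show False using w(2) \<open>z \<inter> w = {}\<close> by blast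
  next
    case True
    \<comment> \<open>With no common element in \<open>D\<close>, this is the part of
      \<open>D\<close> outside \<open>z \<union> w\<close>, while \<open>D \<triangle> z\<close> is
      \<open>D - z\<close> together with \<open>e\<close>. One circuit would properly contain the
      other.\<close>
    let ?u = "sym_diff D (sym_diff z w)"
    have u: "?u \<in> Z" using Z_closed[OF Z_D s(1)] .
    have "?u \<noteq> {}" using ne(2) by blast
    moreover have "?u \<noteq> D" using s(2) by blast
    ultimately have cu: "circuit M ?u" using u circuit_iff by blast
    have "e \<in> sym_diff D z" using True by blast
    have "sym_diff D z \<in> Z" using Z_closed[OF Z_D z(1)] .
    moreover have "sym_diff D z \<noteq> {}" "sym_diff D z \<noteq> D" using True by blast+
    ultimately have cd: "circuit M (sym_diff D z)" using circuit_iff by blast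
    have "?u \<subseteq> sym_diff D z" using empty True zE by blast
    then have "?u = sym_diff D z" using circuit_subset_eq[OF cu cd] by blast
    moreover have "e \<notin> ?u" using True by blast
    ultimately show False using \<open>e \<in> sym_diff D z\<close> by blast
  qed
qed

text \<open>A tuple of \<open>r\<close> members of \<open>Z\<close> that starts with
  \<open>D\<close>, the \<open>i\<close>-th member being \<open>support E \<Phi> {i}\<close>; so
  \<open>\<Phi> x\<close> lists the memberships of \<open>x\<close>. That only \<open>S = {}\<close>
  has empty support is linear independence of the tuple.\<close>

definition coordinates :: "nat \<Rightarrow> ('a \<Rightarrow> bitvec) \<Rightarrow> bool" where
  "coordinates r \<Phi> \<longleftrightarrow> r \<ge> 1 \<and> (\<forall>x i. i \<ge> r \<longrightarrow> \<Phi> x i = 0) \<and> (\<forall>x. \<Phi> x 0 = (if x = e then 0 else 1)) \<and>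
     (\<forall>S\<subseteq>{..<r}. support E \<Phi> S \<in> Z \<and> (support E \<Phi> S = {} \<longrightarrow> S = {}))"

lemma coordinates_inj:
  assumes "coordinates r \<Phi>"
  shows "inj_on (support E \<Phi>) (Pow {..<r})"
proof (rule inj_onI)
  fix S T assume ST: "S \<in> Pow {..<r}" "T \<in> Pow {..<r}" "support E \<Phi> S = support E \<Phi> T"
  then have "finite S" "finite T" using finite_subset[of S "{..<r}"] finite_subset[of T "{..<r}"] by auto
  then have "support E \<Phi> (sym_diff S T) = {}" using ST(3) by (simp add: support_sym_diff)
  moreover have "sym_diff S T \<subseteq> {..<r}" using ST by blast
  ultimately have "sym_diff S T = {}" using assms unfolding coordinates_def by blast
  then show "S = T" by blast
qed

text \<open>A longest tuple spans \<open>Z\<close>, since a member \<open>w\<close> outside the span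
  could be appended as coordinate \<open>r\<close>. The length is bounded because the
  \<open>2 ^ r\<close> sums are distinct members of the finite set \<open>Z\<close>.\<close>

lemma coordinates_exist:
  obtains r \<Phi> where "coordinates r \<Phi>" "support E \<Phi> ` Pow {..<r} = Z"
proof -
  let ?\<Phi>1 = "\<lambda>x i. if i = 0 \<and> x \<noteq> e then 1 else (0::bit)"
  have "D \<noteq> {}" using Z_small by blast
  have one: "coordinates 1 ?\<Phi>1"
    unfolding coordinates_def
  proof (intro conjI allI impI)
    fix S :: "nat set" assume "S \<subseteq> {..<1}"
    then consider "S = {}" | "S = {0}" by (auto simp: lessThan_Suc subset_singleton_iff)
    moreover have "support E ?\<Phi>1 {0} = D" by (auto simp: support_def)
    ultimately show "support E ?\<Phi>1 S \<in> Z" "support E ?\<Phi>1 S = {} \<Longrightarrow> S = {}"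
      using Z_empty Z_D \<open>D \<noteq> {}\<close> by (cases, auto)+
  qed auto
  have bound: "r \<le> card Z" if "coordinates r \<Phi>" for r \<Phi>
  proof -
    have "support E \<Phi> ` Pow {..<r} \<subseteq> Z" using that unfolding coordinates_def by blast
    then have "card (support E \<Phi> ` Pow {..<r}) \<le> card Z" using finite_Z card_mono by blast
    then have "2 ^ r \<le> card Z" using coordinates_inj[OF that] by (simp add: card_image card_Pow)
    then show ?thesis using less_exp[of r] by linarith
  qed
  obtain r where r: "\<exists>\<Phi>. coordinates r \<Phi>" and max: "\<And>r'. \<exists>\<Phi>. coordinates r' \<Phi> \<Longrightarrow> r' \<le> r"
    using Nat.ex_has_greatest_nat[of "\<lambda>r. \<exists>\<Phi>. coordinates r \<Phi>" 1 "card Z"] one bound by blast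
  then obtain \<Phi> where \<Phi>: "coordinates r \<Phi>" by blast
  have "w \<in> support E \<Phi> ` Pow {..<r}" if w: "w \<in> Z" for w
  proof (rule ccontr)
    assume nw: "w \<notin> support E \<Phi> ` Pow {..<r}"
    define \<Psi> where "\<Psi> x = (\<Phi> x)(r := if x \<in> w then 1 else 0)" for x
    have old: "support E \<Psi> S = support E \<Phi> S" if "S \<subseteq> {..<r}" for S
    proof -
      have "dot S (\<Psi> x) = dot S (\<Phi> x)" for x using that by (intro dot_cong) (auto simp: \<Psi>_def)
      then show ?thesis by (simp add: support_def)
    qed
    have new: "support E \<Psi> {r} = w" using Z_subset[OF w] by (auto simp: support_def \<Psi>_def)
    have "coordinates (Suc r) \<Psi>"
      unfolding coordinates_def
    proof (intro conjI allI impI)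
      show "\<Psi> x i = 0" if "Suc r \<le> i" for x i using \<Phi> that unfolding coordinates_def \<Psi>_def by auto
      show "\<Psi> x 0 = (if x = e then 0 else 1)" for x using \<Phi> unfolding coordinates_def \<Psi>_def by auto
      fix S assume S: "S \<subseteq> {..<Suc r}"
      define S0 where "S0 = S - {r}"
      have S0: "S0 \<subseteq> {..<r}" using S by (auto simp: S0_def)
      have s0: "support E \<Phi> S0 \<in> Z" "support E \<Phi> S0 = {} \<Longrightarrow> S0 = {}"
        using \<Phi> S0 unfolding coordinates_def by blast+
      have "support E \<Psi> S \<in> Z \<and> (support E \<Psi> S = {} \<longrightarrow> S = {})"
      proof (cases "r \<in> S")
        case False
        then have "S0 = S" by (simp add: S0_def)
        then show ?thesis using s0 old[OF S0] by simp
      next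
        case True
        then have "S = sym_diff S0 {r}" by (auto simp: S0_def)
        moreover have "support E \<Psi> (sym_diff S0 {r}) = sym_diff (support E \<Psi> S0) (support E \<Psi> {r})"
          using finite_subset[OF S0] by (intro support_sym_diff) auto
        ultimately have eq: "support E \<Psi> S = sym_diff (support E \<Phi> S0) w" using old[OF S0] new by simp
        have "support E \<Phi> S0 \<noteq> w" using nw S0 by blast
        then have "sym_diff (support E \<Phi> S0) w \<noteq> {}" by blast
        then show ?thesis unfolding eq using Z_closed[OF s0(1) w] by metis
      qed
      then show "support E \<Psi> S \<in> Z" "support E \<Psi> S = {} \<Longrightarrow> S = {}" by auto
    qed simp
    then show False using max by (meson Suc_n_not_le_n)
  qed
  moreover have "support E \<Phi> ` Pow {..<r} \<subseteq> Z" using \<Phi> unfolding coordinates_def by blast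
  ultimately have "support E \<Phi> ` Pow {..<r} = Z" by (intro equalityI subsetI) auto
  then show ?thesis using that[OF \<Phi>] by simp
qed

lemma affine_representation:
  "\<exists>d\<ge>2. \<exists>e'\<in>hyperplane_at_infinity d. \<exists>X\<subseteq>ground (AG_plus d e'). e' \<notin> X \<and>
     \<not> contains_copy (restrict (AG d) X) (AG (d - 2)) \<and> isomorphic (dual M) (delete (AG_plus d e') X)"
proof -
  obtain r \<Phi> where co: "coordinates r \<Phi>" and Zr: "support E \<Phi> ` Pow {..<r} = Z" using coordinates_exist .
  let ?supp = "support E \<Phi>"
  have r1: "r \<ge> 1" and \<Phi>r: "\<And>x i. i \<ge> r \<Longrightarrow> \<Phi> x i = 0" and \<Phi>0: "\<And>x. \<Phi> x 0 = (if x = e then 0 else 1)"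
    using co unfolding coordinates_def by auto
  note supp_inj = inj_onD[OF coordinates_inj[OF co]]
  obtain d1 where d1: "d1 \<in> Z" "d1 \<noteq> {}" "d1 \<subset> D" using Z_small by blast
  obtain c where c: "c \<in> Z" "e \<in> c" using Z_e by blast
  obtain c' where c': "c' \<in> Z" "e \<in> c'" "c \<noteq> c'"
  proof
    show "sym_diff c D \<in> Z" using Z_closed[OF c(1) Z_D] .
    show "e \<in> sym_diff c D" using c by blast
    show "c \<noteq> sym_diff c D" using d1 by blast
  qed
  \<comment> \<open>Five distinct members exceed \<open>2 ^ 2\<close>, which forces
    \<open>r \<ge> 3\<close>.\<close>
  have "card {{}, D, d1, c, c'} \<le> card Z"
    using finite_Z Z_empty Z_D d1 c c' by (intro card_mono) auto
  moreover have "e \<notin> d1" "d1 \<noteq> D" "D \<noteq> {}" "c \<noteq> {}" "c' \<noteq> {}" using c c' d1 by auto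
  then have "{} \<notin> {D, d1, c, c'}" "D \<notin> {d1, c, c'}" "d1 \<notin> {c, c'}" "c \<notin> {c'}"
    using c(2) c'(2,3) d1(2) by auto
  then have "card {{}, D, d1, c, c'} = 5" by (simp only: card_insert_disjoint finite.intros card.empty not_False_eq_True) simp
  moreover have "card Z = 2 ^ r" using Zr card_image[OF coordinates_inj[OF co]] by (simp add: card_Pow)
  ultimately have "2 ^ 2 < (2::nat) ^ r" by simp
  then have "2 < r" using power_less_imp_less_exp[of "2::nat" 2 r] by simp
  then obtain d where d: "r = Suc d" "d \<ge> 2" by (cases r) auto
  have inj: "inj_on \<Phi> E"
  proof (rule inj_onI, rule ccontr)
    fix x y assume xy: "x \<in> E" "y \<in> E" "\<Phi> x = \<Phi> y" "x \<noteq> y"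
    then obtain z where "z \<in> Z" "(x \<in> z) \<noteq> (y \<in> z)" using Z_separate by blast
    then show False using Zr xy(1,2,3) by (auto simp: support_def)
  qed
  have supp0: "?supp {0} = D" using \<Phi>0 by (auto simp: support_def split: if_splits)
  have "\<Phi> e \<noteq> 0"
  proof
    assume "\<Phi> e = 0"
    then show False using c Zr by (auto simp: support_def)
  qed
  then have e': "\<Phi> e \<in> hyperplane_at_infinity d"
    using \<Phi>0 \<Phi>r d by (auto simp: hyperplane_at_infinity_def ground_PG)
  have \<Phi>D: "\<Phi> x \<in> ground (AG d)" if "x \<in> D" for x
    using that \<Phi>0 \<Phi>r d by (simp add: ground_AG)
  let ?G = "ground (AG_plus d (\<Phi> e))"
  let ?X = "?G - \<Phi> ` E"
  have \<Phi>G: "\<Phi> ` E \<subseteq> ?G" using \<Phi>D unfolding ground_AG_plus[OF e'] by blast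
  have "\<not> contains_copy (restrict (AG d) ?X) (AG (d - 2))"
  proof
    assume "contains_copy (restrict (AG d) ?X) (AG (d - 2))"
    then obtain Y f where Y: "Y \<subseteq> ?X \<inter> ground (AG d)" and f: "bij_betw f Y (ground (AG (d - 2)))"
      and ind: "\<forall>I\<subseteq>Y. bitvec.independent I \<longleftrightarrow> bitvec.independent (f ` I)"
      unfolding contains_copy_AG_iff by blast
    have "Y \<subseteq> ground (AG d)" using Y by blast
    then obtain S T a b where S: "S \<subseteq> {1..d}" "T \<subseteq> {1..d}" "S \<noteq> {}" "T \<noteq> {}" "S \<noteq> T"
      and eqs: "\<And>v. v \<in> ground (AG d) \<Longrightarrow> dot S v = a \<Longrightarrow> dot T v = b \<Longrightarrow> v \<in> Y"
      using equations_if_AG_copy[OF d(2) _ f] ind by metis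
    have avoid: "\<not> (dot S (\<Phi> x) = a \<and> dot T (\<Phi> x) = b)" if "x \<in> D" for x
      using eqs[OF \<Phi>D[OF that]] Y that by blast
    \<comment> \<open>As coordinate 0 is one on affine points, inserting index 0 flips the value of
      a functional. Every equation, whatever its right-hand side, thus becomes membership in a
      support.\<close>
    have shift: "\<exists>S'\<subseteq>{..<r}. S' - {0} = S \<and> (\<forall>v. v 0 = 1 \<longrightarrow> (dot S' v = 1 \<longleftrightarrow> dot S v = a))"
      if "S \<subseteq> {1..d}" for S a
    proof (cases "a = 1")
      case True
      then show ?thesis using that d by (intro exI[of _ S]) auto
    next
      case False
      have "0 \<notin> S" "finite S" using that finite_subset[OF that] by auto
      then have "v 0 = 1 \<longrightarrow> (dot (insert 0 S) v = 1 \<longleftrightarrow> dot S v = a)" for v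
        using False by (cases "dot S v"; cases a) (auto simp: dot_insert)
      then show ?thesis using that d \<open>0 \<notin> S\<close> by (intro exI[of _ "insert 0 S"]) auto
    qed
    obtain S' where S': "S' \<subseteq> {..<r}" "S' - {0} = S" "\<And>v. v 0 = 1 \<Longrightarrow> dot S' v = 1 \<longleftrightarrow> dot S v = a"
      using shift[OF S(1), of a] by blast
    obtain T' where T': "T' \<subseteq> {..<r}" "T' - {0} = T" "\<And>v. v 0 = 1 \<Longrightarrow> dot T' v = 1 \<longleftrightarrow> dot T v = b"
      using shift[OF S(2), of b] by blast
    have fin: "finite S'" "finite T'" using finite_subset[OF S'(1)] finite_subset[OF T'(1)] by simp_all
    have inZ: "?supp S' \<in> Z" "?supp T' \<in> Z" using Zr S'(1) T'(1) by blast+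
    have r0: "{} \<in> Pow {..<r}" "{0} \<in> Pow {..<r}" using r1 by auto
    have ST': "S' \<in> Pow {..<r}" "T' \<in> Pow {..<r}" using S'(1) T'(1) by simp_all
    have neq: "S' \<noteq> {}" "T' \<noteq> {}" "S' \<noteq> {0}" "T' \<noteq> {0}" "S' \<noteq> T'"
      using S'(2) T'(2) S(3-5) by auto
    have "?supp S' \<noteq> {}" "?supp T' \<noteq> {}"
      using supp_inj[OF _ ST'(1) r0(1)] supp_inj[OF _ ST'(2) r0(1)] neq by auto
    moreover have "?supp S' \<noteq> D" "?supp T' \<noteq> D"
      using supp_inj[OF _ ST'(1) r0(2)] supp_inj[OF _ ST'(2) r0(2)] neq supp0 by metis+
    moreover have "?supp S' \<noteq> ?supp T'" using supp_inj[OF _ ST'] neq by metis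
    moreover have "sym_diff (?supp S') (?supp T') \<noteq> D"
    proof
      assume "sym_diff (?supp S') (?supp T') = D"
      then have "?supp (sym_diff S' T') = ?supp {0}" unfolding supp0 support_sym_diff[OF fin] .
      moreover have "sym_diff S' T' \<in> Pow {..<r}" using S'(1) T'(1) by blast
      ultimately have "sym_diff S' T' = {0}" using supp_inj[OF _ _ r0(2)] by blast
      then have "S' - {0} = T' - {0}" by blast
      then show False using S'(2) T'(2) S(5) by simp
    qed
    ultimately have "?supp S' \<inter> ?supp T' \<inter> D \<noteq> {}" using circuits_meet_in_D[OF inZ(1) _ _ inZ(2)] by metis
    then obtain x where x: "x \<in> D" "dot S' (\<Phi> x) = 1" "dot T' (\<Phi> x) = 1" by (auto simp: support_def)
    have "\<Phi> x 0 = 1" using x(1) \<Phi>0 by simp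
    then show False using avoid[OF x(1)] x S'(3) T'(3) by blast
  qed
  moreover have "isomorphic (dual M) (delete (AG_plus d (\<Phi> e)) ?X)"
    unfolding isomorphic_delete_AG_plus_iff ground_dual
  proof (intro exI[of _ \<Phi>] conjI allI impI)
    have "?G - ?X = \<Phi> ` E" using \<Phi>G by blast
    then show "bij_betw \<Phi> E (?G - ?X)" using inj by (simp add: bij_betw_def)
    fix I assume I: "I \<subseteq> E"
    have "I \<in> indep_sets (dual M) \<longleftrightarrow> parity_indep Z I"
      by (rule dual_indep_iff_parity_indep[OF M _ _ _ I]) (rule Z_closed Z_subset dependent_iff; assumption)+
    also have "\<dots> \<longleftrightarrow> bitvec.independent (\<Phi> ` I)"
      unfolding Zr[symmetric]
      using inj_on_subset[OF inj I] finite_subset[OF I matroid_finite[OF M]] I \<Phi>r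
      by (intro independent_image_iff_parity_indep[symmetric]) auto
    finally show "I \<in> indep_sets (dual M) \<longleftrightarrow> bitvec.independent (\<Phi> ` I)" .
  qed
  moreover have "\<Phi> e \<notin> ?X" using eE by blast
  ultimately show ?thesis using d(2) e' by (intro exI[of _ d] conjI bexI[of _ "\<Phi> e"] exI[of _ ?X]) auto
qed

end

theorem corollary4p5:
  fixes M :: "'a matroid"
  assumes "is_matroid M"
  shows "excluded_series_minor circuit_difference M \<longleftrightarrow>
           (\<exists>n::nat. n \<ge> 2 \<and> isomorphic M (uniform n (n + 2))) \<or>
           (\<exists>r::nat. r \<ge> 3 \<and>
              (\<exists>e \<in> hyperplane_at_infinity (r - 1). \<exists>X \<subseteq> ground (AG_plus (r - 1) e).
                 e \<notin> X \<and>
                 \<not> contains_copy (restrict (AG (r - 1)) X) (AG (r - 3)) \<and>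
                 isomorphic (dual M) (delete (AG_plus (r - 1) e) X)))"
    (is "_ \<longleftrightarrow> _ \<or> (\<exists>r. r \<ge> 3 \<and> ?affine (r - 1) (r - 3))")
proof -
  have "(\<exists>e Z. almost_cycle_space M e Z) \<longleftrightarrow> (\<exists>d\<ge>2. ?affine d (d - 2))"
  proof
    assume "\<exists>e Z. almost_cycle_space M e Z"
    then obtain e Z where "almost_cycle_space M e Z" by blast
    then interpret almost_cycle_space_matroid M e Z using assms by unfold_locales
    show "\<exists>d\<ge>2. ?affine d (d - 2)" using affine_representation .
  next
    assume "\<exists>d\<ge>2. ?affine d (d - 2)"
    then obtain d e X where d: "d \<ge> 2" "e \<in> hyperplane_at_infinity d" "e \<notin> X"
      "\<not> contains_copy (restrict (AG d) X) (AG (d - 2))"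
      and iso: "isomorphic (dual M) (delete (AG_plus d e) X)"
      by blast
    obtain \<Phi> where "bij_betw \<Phi> (ground M) (ground (AG_plus d e) - X)"
      "\<forall>I\<subseteq>ground M. I \<in> indep_sets (dual M) \<longleftrightarrow> bitvec.independent (\<Phi> ` I)"
      using iso unfolding isomorphic_delete_AG_plus_iff ground_dual by blast
    then show "\<exists>e Z. almost_cycle_space M e Z"
      using almost_cycle_space_if_affine[OF assms d, of \<Phi>] by simp
  qed
  also have "\<dots> \<longleftrightarrow> (\<exists>r\<ge>3. ?affine (r - 1) (r - 3))"
  proof
    assume "\<exists>d\<ge>2. ?affine d (d - 2)"
    then obtain d where d: "d \<ge> 2" "?affine d (d - 2)" by blast
    have "?affine (Suc d - 1) (Suc d - 3)" using d(2) by (simp add: numeral_3_eq_3 numeral_2_eq_2)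
    then show "\<exists>r\<ge>3. ?affine (r - 1) (r - 3)" using d(1) by (intro exI[of _ "Suc d"]) simp
  next
    assume "\<exists>r\<ge>3. ?affine (r - 1) (r - 3)"
    then obtain r where r: "r \<ge> 3" "?affine (r - 1) (r - 3)" by blast
    moreover have "r - 3 = r - 1 - 2" by simp
    ultimately show "\<exists>d\<ge>2. ?affine d (d - 2)" by (intro exI[of _ "r - 1"]) auto
  qed
  finally show ?thesis unfolding excluded_iff_uniform_or_almost_cycle_space[OF assms] by simp
qed

end
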